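(* Let $K\subseteq F$ be a field extension with $K$ algebraically closed. Let $A$ and $B$ be two $K$-algebras having finite dimension as $K$-vector spaces. Then $A_F$ and $B_F$ are isomorphic as $F$-algebras if and only if $A$ and $B$ are isomorphic as $K$-algebras.
   Context: Algebras are not necessarily associative, commutative or unital. For a $K$-algebra $A$ and a field extension $K\subseteq F$, $A_F:=A\otimes_K F$, regarded as an $F$-algebra. *)

theory Defs
  imports
    "HOL-Library.Poly_Mapping"
    "HOL-Computational_Algebra.Computational_Algebra"
begin

text \<open>A field extension \<open>K \<subseteq> F\<close> is given by its inclusion map \<open>\<iota> : K \<rightarrow> F\<close>, a homomorphism of
  fields; injectivity is automatic.\<close>

locale field_extension =
  fixes \<iota> :: "'k::field \<Rightarrow> 'f::field"
  assumes map_add: "\<iota> (x + y) = \<iota> x + \<iota> y"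
    and map_mult: "\<iota> (x * y) = \<iota> x * \<iota> y"
    and map_one: "\<iota> 1 = 1"

text \<open>An algebra is a vector space with a bilinear product: no associativity, commutativity or
  unit is assumed.\<close>

locale nonassoc_algebra = vector_space scale
  for scale :: "'k::field \<Rightarrow> 'a::ab_group_add \<Rightarrow> 'a" +
  fixes mult :: "'a \<Rightarrow> 'a \<Rightarrow> 'a"
  assumes linear_mult_right: "Vector_Spaces.linear scale scale (\<lambda>y. mult x y)"
    and linear_mult_left: "Vector_Spaces.linear scale scale (\<lambda>x. mult x y)"

text \<open>The underlying data of an algebra over \<open>'k\<close> with an explicit carrier. Carriers are needed
  since the scalar extension below lives on a quotient depending on the extension map and the
  scalar multiplication, so it cannot be a type.\<close>

record ('k, 'v) algebra_data =
  alg_carrier :: "'v set"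
  alg_add :: "'v \<Rightarrow> 'v \<Rightarrow> 'v"
  alg_smult :: "'k \<Rightarrow> 'v \<Rightarrow> 'v"
  alg_mult :: "'v \<Rightarrow> 'v \<Rightarrow> 'v"

definition algebra_iso :: "('k, 'v) algebra_data \<Rightarrow> ('k, 'w) algebra_data \<Rightarrow> ('v \<Rightarrow> 'w) \<Rightarrow> bool"
  where "algebra_iso V W \<phi> \<longleftrightarrow>
    bij_betw \<phi> (alg_carrier V) (alg_carrier W) \<and>
    (\<forall>x\<in>alg_carrier V. \<forall>y\<in>alg_carrier V. \<phi> (alg_add V x y) = alg_add W (\<phi> x) (\<phi> y)) \<and>
    (\<forall>c. \<forall>x\<in>alg_carrier V. \<phi> (alg_smult V c x) = alg_smult W c (\<phi> x)) \<and>
    (\<forall>x\<in>alg_carrier V. \<forall>y\<in>alg_carrier V. \<phi> (alg_mult V x y) = alg_mult W (\<phi> x) (\<phi> y))"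

definition algebra_isomorphic :: "('k, 'v) algebra_data \<Rightarrow> ('k, 'w) algebra_data \<Rightarrow> bool"
  where "algebra_isomorphic V W \<longleftrightarrow> (\<exists>\<phi>. algebra_iso V W \<phi>)"

definition algebra_of ::
  "('k \<Rightarrow> 'a \<Rightarrow> 'a) \<Rightarrow> ('a \<Rightarrow> 'a \<Rightarrow> 'a) \<Rightarrow> ('k, 'a::ab_group_add) algebra_data"
  where "algebra_of scale m = \<lparr>alg_carrier = UNIV, alg_add = (+), alg_smult = scale, alg_mult = m\<rparr>"


subsection \<open>The tensor product \<open>A \<otimes>\<^sub>K F\<close>\<close>

text \<open>As usual, \<open>A \<otimes>\<^sub>K F\<close> is the free abelian group on \<open>A \<times> F\<close>, whose basis element at
  \<open>(a, c)\<close> is \<open>frag_of (a, c)\<close>, modulo the subgroup generated by the relations expressing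
  biadditivity and \<open>K\<close>-balancedness of \<open>(a, c) \<mapsto> a \<otimes> c\<close>.\<close>

definition tensor_relators ::
  "('k \<Rightarrow> 'f) \<Rightarrow> ('k \<Rightarrow> 'a \<Rightarrow> 'a) \<Rightarrow> (('a::ab_group_add \<times> 'f::field) \<Rightarrow>\<^sub>0 int) set"
  where "tensor_relators \<iota> scale =
    {frag_of (a + b, c) - frag_of (a, c) - frag_of (b, c) | a b c. True} \<union>
    {frag_of (a, c + d) - frag_of (a, c) - frag_of (a, d) | a c d. True} \<union>
    {frag_of (scale k a, c) - frag_of (a, \<iota> k * c) | k a c. True}"

definition tensor_rel ::
  "('k \<Rightarrow> 'f) \<Rightarrow> ('k \<Rightarrow> 'a \<Rightarrow> 'a) \<Rightarrow> (('a::ab_group_add \<times> 'f::field) \<Rightarrow>\<^sub>0 int) rel"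
  where "tensor_rel \<iota> scale = {(x, y). x - y \<in> group_closure (tensor_relators \<iota> scale)}"

text \<open>The additive extensions of \<open>a \<otimes> d \<mapsto> a \<otimes> c d\<close> and of
  \<open>(a \<otimes> c, b \<otimes> d) \<mapsto> a b \<otimes> c d\<close> to the free abelian group.\<close>

definition free_smult :: "'f \<Rightarrow> (('a \<times> 'f::field) \<Rightarrow>\<^sub>0 int) \<Rightarrow> (('a \<times> 'f) \<Rightarrow>\<^sub>0 int)"
  where "free_smult c x = frag_extend (\<lambda>(a, d). frag_of (a, c * d)) x"

definition free_mult :: "('a \<Rightarrow> 'a \<Rightarrow> 'a) \<Rightarrow>
    (('a \<times> 'f::field) \<Rightarrow>\<^sub>0 int) \<Rightarrow> (('a \<times> 'f) \<Rightarrow>\<^sub>0 int) \<Rightarrow> (('a \<times> 'f) \<Rightarrow>\<^sub>0 int)"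
  where "free_mult m x y =
    frag_extend (\<lambda>(a, c). frag_extend (\<lambda>(b, d). frag_of (m a b, c * d)) y) x"

text \<open>The \<open>F\<close>-algebra \<open>A\<^sub>F = A \<otimes>\<^sub>K F\<close>. Its operations are those induced on equivalence classes;
  the lemmas after the definition show that they are well defined.\<close>

definition scalar_extension :: "('k \<Rightarrow> 'f) \<Rightarrow> ('k \<Rightarrow> 'a \<Rightarrow> 'a) \<Rightarrow> ('a \<Rightarrow> 'a \<Rightarrow> 'a) \<Rightarrow>
    ('f::field, (('a::ab_group_add \<times> 'f) \<Rightarrow>\<^sub>0 int) set) algebra_data"
  where "scalar_extension \<iota> scale m = (let R = tensor_rel \<iota> scale in
    \<lparr>alg_carrier = UNIV // R,
     alg_add = (\<lambda>X Y. \<Union>x\<in>X. \<Union>y\<in>Y. R `` {x + y}),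
     alg_smult = (\<lambda>c X. \<Union>x\<in>X. R `` {free_smult c x}),
     alg_mult = (\<lambda>X Y. \<Union>x\<in>X. \<Union>y\<in>Y. R `` {free_mult m x y})\<rparr>)"

lemma equiv_tensor_rel: "equiv UNIV (tensor_rel \<iota> scale)"
proof (rule equivI)
  show "sym (tensor_rel \<iota> scale)"
  proof (rule symI)
    fix x y assume "(x, y) \<in> tensor_rel \<iota> scale"
    then have "- (x - y) \<in> group_closure (tensor_relators \<iota> scale)"
      by (simp only: group_closure_minus_iff tensor_rel_def mem_Collect_eq prod.case)
    then show "(y, x) \<in> tensor_rel \<iota> scale" by (simp add: tensor_rel_def)
  qed
  show "trans (tensor_rel \<iota> scale)"
  proof (rule transI)
    fix x y z assume "(x, y) \<in> tensor_rel \<iota> scale" "(y, z) \<in> tensor_rel \<iota> scale"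
    then have "(x - y) + (y - z) \<in> group_closure (tensor_relators \<iota> scale)"
      by (intro group_closure_add) (simp_all add: tensor_rel_def)
    then show "(x, z) \<in> tensor_rel \<iota> scale" by (simp add: tensor_rel_def)
  qed
qed (auto simp: tensor_rel_def refl_on_def)

lemma group_closure_map:
  fixes f :: "'a::ab_group_add \<Rightarrow> 'b::ab_group_add"
  assumes diff: "\<And>x y. f (x - y) = f x - f y"
    and gen: "\<And>s. s \<in> S \<Longrightarrow> f s \<in> group_closure T"
    and "x \<in> group_closure S"
  shows "f x \<in> group_closure T"
  using assms(3)
proof (induction rule: group_closure.induct)
  case (base s)
  have "f 0 = 0" using diff[of 0 0] by simp
  with base gen show ?case by auto
next
  case (diff s t)
  then show ?case by (simp add: assms(1) group_closure.diff)
qed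

lemma free_smult_diff: "free_smult c (x - y) = free_smult c x - free_smult c y"
  by (simp add: free_smult_def frag_extend_diff)

lemma free_mult_diff_left: "free_mult m (x - x') y = free_mult m x y - free_mult m x' y"
  by (simp add: free_mult_def frag_extend_diff)

lemma frag_induct [case_names zero one diff]:
  assumes "P 0" "\<And>p. P (frag_of p)" "\<And>a b. P a \<Longrightarrow> P b \<Longrightarrow> P (a - b)"
  shows "P x"
  by (rule frag_induction[OF subset_UNIV]) (use assms in auto)

lemma frag_cmul_right_diff: "frag_cmul n (a - b) = frag_cmul n a - frag_cmul n b"
  by (rule poly_mapping_eqI) (simp add: lookup_minus right_diff_distrib)

lemma free_mult_swap:
  "free_mult m x y = frag_extend (\<lambda>(b, d). frag_extend (\<lambda>(a, c). frag_of (m a b, c * d)) x) y"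
proof (induction x rule: frag_induct)
  case zero
  have "frag_extend (\<lambda>_. 0) y = (0 :: 'a \<times> 'b \<Rightarrow>\<^sub>0 int)"
    by (simp add: frag_extend_def)
  then show ?case by (simp add: free_mult_def case_prod_unfold)
next
  case (one x)
  then show ?case by (simp add: free_mult_def case_prod_unfold)
next
  case (diff a b)
  have "frag_extend (\<lambda>p. g p - h p) y = frag_extend g y - frag_extend h y"
    for g h :: "'a \<times> 'b \<Rightarrow> 'a \<times> 'b \<Rightarrow>\<^sub>0 int"
    by (simp add: frag_extend_def frag_cmul_right_diff sum_subtractf)
  with diff show ?case
    by (simp add: free_mult_diff_left frag_extend_diff case_prod_unfold)
qed

lemma free_mult_diff_right: "free_mult m x (y - y') = free_mult m x y - free_mult m x y'"
  by (simp add: free_mult_swap frag_extend_diff)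

lemma tensor_relatorsI:
  "frag_of (a + b, c) - frag_of (a, c) - frag_of (b, c) \<in> tensor_relators \<iota> scale"
  "frag_of (a, c + d) - frag_of (a, c) - frag_of (a, d) \<in> tensor_relators \<iota> scale"
  "d = \<iota> k * c \<Longrightarrow> frag_of (scale k a, c) - frag_of (a, d) \<in> tensor_relators \<iota> scale"
  unfolding tensor_relators_def by blast+

lemma tensor_relatorsE:
  assumes "s \<in> tensor_relators \<iota> scale"
  obtains a b c where "s = frag_of (a + b, c) - frag_of (a, c) - frag_of (b, c)"
  | a c d where "s = frag_of (a, c + d) - frag_of (a, c) - frag_of (a, d)"
  | k a c where "s = frag_of (scale k a, c) - frag_of (a, \<iota> k * c)"
  using assms unfolding tensor_relators_def by blast

lemma congruent_add:
  "congruent2 (tensor_rel \<iota> scale) (tensor_rel \<iota> scale) (\<lambda>x y. tensor_rel \<iota> scale `` {x + y})"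
proof (rule congruent2I')
  fix x x' y y' assume *: "(x, x') \<in> tensor_rel \<iota> scale" "(y, y') \<in> tensor_rel \<iota> scale"
  have "x + y - (x' + y') = (x - x') + (y - y')" by simp
  with * have "(x + y, x' + y') \<in> tensor_rel \<iota> scale"
    by (simp only: tensor_rel_def mem_Collect_eq prod.case group_closure_add)
  then show "tensor_rel \<iota> scale `` {x + y} = tensor_rel \<iota> scale `` {x' + y'}"
    by (rule equiv_class_eq[OF equiv_tensor_rel])
qed

lemma congruent_smult:
  "congruent (tensor_rel \<iota> scale) (\<lambda>x. tensor_rel \<iota> scale `` {free_smult c x})"
proof (rule congruentI)
  fix x y assume "(x, y) \<in> tensor_rel \<iota> scale"
  then have xy: "x - y \<in> group_closure (tensor_relators \<iota> scale)"
    by (simp add: tensor_rel_def)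
  have gen: "free_smult c s \<in> group_closure (tensor_relators \<iota> scale)"
    if "s \<in> tensor_relators \<iota> scale" for s
  proof (rule group_closure.base)
    from that show "free_smult c s \<in> insert 0 (tensor_relators \<iota> scale)"
      by (elim tensor_relatorsE; simp add: free_smult_def frag_extend_diff
            ring_distribs mult.assoc mult.left_commute tensor_relatorsI)
  qed
  have "free_smult c (x - y) \<in> group_closure (tensor_relators \<iota> scale)"
    by (rule group_closure_map[where f = "free_smult c", OF free_smult_diff gen xy])
  then have "(free_smult c x, free_smult c y) \<in> tensor_rel \<iota> scale"
    by (simp add: tensor_rel_def free_smult_diff)
  then show "tensor_rel \<iota> scale `` {free_smult c x} = tensor_rel \<iota> scale `` {free_smult c y}"
    by (rule equiv_class_eq[OF equiv_tensor_rel])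
qed

lemma congruent_mult:
  assumes "nonassoc_algebra scale m"
  shows "congruent2 (tensor_rel \<iota> scale) (tensor_rel \<iota> scale)
    (\<lambda>x y. tensor_rel \<iota> scale `` {free_mult m x y})"
proof (rule congruent2I')
  interpret nonassoc_algebra scale m by fact
  let ?N = "group_closure (tensor_relators \<iota> scale)"
  have m_left: "m (a + a') b = m a b + m a' b" "m (scale k a) b = scale k (m a b)" for a a' b k
    using linear_mult_left[of b] unfolding Vector_Spaces.linear_iff by blast+
  have m_right: "m a (b + b') = m a b + m a b'" "m a (scale k b) = scale k (m a b)" for a b b' k
    using linear_mult_right[of a] unfolding Vector_Spaces.linear_iff by blast+
  have left: "free_mult m s y \<in> ?N" if s: "s \<in> tensor_relators \<iota> scale" for s y
  proof (induction y rule: frag_induct)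
    case zero
    show ?case by (simp add: free_mult_swap)
  next
    case (one p)
    have "free_mult m s (frag_of p) \<in> insert 0 (tensor_relators \<iota> scale)"
      using s
      by (cases p) (elim tensor_relatorsE; simp add: free_mult_swap frag_extend_diff m_left
            ring_distribs mult.assoc mult.left_commute tensor_relatorsI)
    then show ?case by (rule group_closure.base)
  next
    case (diff a b)
    then show ?case by (simp add: free_mult_diff_right group_closure.diff)
  qed
  have right: "free_mult m x s \<in> ?N" if s: "s \<in> tensor_relators \<iota> scale" for s x
  proof (induction x rule: frag_induct)
    case zero
    show ?case by (simp add: free_mult_def)
  next
    case (one p)
    have "free_mult m (frag_of p) s \<in> insert 0 (tensor_relators \<iota> scale)"
      using s
      by (cases p) (elim tensor_relatorsE; simp add: free_mult_def frag_extend_diff m_right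
            ring_distribs mult.assoc mult.left_commute tensor_relatorsI)
    then show ?case by (rule group_closure.base)
  next
    case (diff a b)
    then show ?case by (simp add: free_mult_diff_left group_closure.diff)
  qed
  fix x x' y y' assume *: "(x, x') \<in> tensor_rel \<iota> scale" "(y, y') \<in> tensor_rel \<iota> scale"
  have "free_mult m (x - x') y \<in> ?N"
    using * by (intro group_closure_map[where f = "\<lambda>x. free_mult m x y", OF free_mult_diff_left left])
      (auto simp: tensor_rel_def)
  moreover have "free_mult m x' (y - y') \<in> ?N"
    using * by (intro group_closure_map[where f = "free_mult m x'", OF free_mult_diff_right right])
      (auto simp: tensor_rel_def)
  ultimately have "free_mult m (x - x') y + free_mult m x' (y - y') \<in> ?N"
    by (rule group_closure_add)
  then have "(free_mult m x y, free_mult m x' y') \<in> tensor_rel \<iota> scale"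
    by (simp add: tensor_rel_def free_mult_diff_left free_mult_diff_right)
  then show "tensor_rel \<iota> scale `` {free_mult m x y} = tensor_rel \<iota> scale `` {free_mult m x' y'}"
    by (rule equiv_class_eq[OF equiv_tensor_rel])
qed

end

theory Submission
  imports Defs
begin

text \<open>An isomorphism between finite-dimensional algebras is, after the choice of bases, a pair of
mutually inverse matrices that is compatible with the structure constants
(\<open>isomorphic_iff_change_of_basis\<close>), that is, a solution of a system of polynomial equations whose
coefficients are built from the structure constants. If \<open>S\<close> is a basis of \<open>A\<close>, then the elements
\<open>b \<otimes> 1\<close> with \<open>b \<in> S\<close> form a basis of \<open>A\<^sub>F\<close> with the same structure constants, viewed in \<open>F\<close>
(\<open>scalar_extension_coordinates\<close>). So for \<open>A\<close>, \<open>B\<close> and for \<open>A\<^sub>F\<close>, \<open>B\<^sub>F\<close> one and the same system of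
equations over \<open>K\<close> has to be solved, once in \<open>K\<close> and once in \<open>F\<close>.

A solution in \<open>K\<close> is a solution in \<open>F\<close>. Conversely, let \<open>R \<subseteq> F\<close> be the \<open>K\<close>-algebra generated by
the finitely many entries of a solution in \<open>F\<close>. Since \<open>K\<close> is algebraically closed, there is a
homomorphism of \<open>K\<close>-algebras \<open>R \<rightarrow> K\<close> (\<open>specialisation\<close>), and it maps the solution to one in \<open>K\<close>.

The homomorphism is built by adjoining the generators one at a time. A homomorphism on \<open>R\<close> extends to
\<open>R[x]\<close> once the image of \<open>x\<close> is chosen to satisfy the images of all relations of \<open>x\<close> over \<open>R\<close>, and this
is possible if a certain nonzero element \<open>u\<close> of \<open>R\<close> is not sent to \<open>0\<close>. The induction therefore
proves more: for every nonzero \<open>v\<close> there is a homomorphism not vanishing at \<open>v\<close>. The step from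
\<open>R\<close> to \<open>R[x]\<close>, where a nonzero \<open>v \<in> R[x]\<close> is traded for a nonzero \<open>u \<in> R\<close>, is
\<open>specialisation_step\<close>.\<close>

section \<open>Homomorphisms defined on subrings\<close>

text \<open>Subrings are plain sets and homomorphisms are total functions that respect the operations on such a
set, because the induction below enlarges a subring of the fixed field \<open>F\<close> one element at a time
and evaluates polynomials over each of these subrings at points of \<open>F\<close>.\<close>

definition is_subring :: "'r::comm_ring_1 set \<Rightarrow> bool"
  where "is_subring R \<longleftrightarrow> 1 \<in> R \<and> (\<forall>x\<in>R. \<forall>y\<in>R. x - y \<in> R \<and> x * y \<in> R)"

definition ring_hom_on :: "'r::comm_ring_1 set \<Rightarrow> ('r \<Rightarrow> 's::comm_ring_1) \<Rightarrow> bool"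
  where "ring_hom_on R \<phi> \<longleftrightarrow> \<phi> 1 = 1 \<and>
    (\<forall>x\<in>R. \<forall>y\<in>R. \<phi> (x + y) = \<phi> x + \<phi> y \<and> \<phi> (x * y) = \<phi> x * \<phi> y)"

lemma subring_closed:
  assumes "is_subring R"
  shows "0 \<in> R" "1 \<in> R" "x \<in> R \<Longrightarrow> y \<in> R \<Longrightarrow> x - y \<in> R" "x \<in> R \<Longrightarrow> y \<in> R \<Longrightarrow> x * y \<in> R"
    "x \<in> R \<Longrightarrow> y \<in> R \<Longrightarrow> x + y \<in> R"
proof -
  show *: "x - y \<in> R" if "x \<in> R" "y \<in> R" for x y
    using assms that by (auto simp: is_subring_def)
  show "1 \<in> R" "x \<in> R \<Longrightarrow> y \<in> R \<Longrightarrow> x * y \<in> R"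
    using assms by (auto simp: is_subring_def)
  then show 0: "0 \<in> R" using *[of 1 1] by simp
  show "x + y \<in> R" if "x \<in> R" "y \<in> R"
    using *[OF that(1) *[OF 0 that(2)]] by simp
qed

lemma subring_sum: "is_subring R \<Longrightarrow> (\<And>i. i \<in> I \<Longrightarrow> f i \<in> R) \<Longrightarrow> sum f I \<in> R"
  by (induction I rule: infinite_finite_induct) (auto simp: subring_closed)

lemma subring_power: "is_subring R \<Longrightarrow> x \<in> R \<Longrightarrow> x ^ n \<in> R"
  by (induction n) (auto simp: subring_closed)

lemma ring_hom_on_simps:
  assumes "is_subring R" "ring_hom_on R \<phi>"
  shows "\<phi> 0 = 0" "\<phi> 1 = 1"
    "x \<in> R \<Longrightarrow> y \<in> R \<Longrightarrow> \<phi> (x + y) = \<phi> x + \<phi> y"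
    "x \<in> R \<Longrightarrow> y \<in> R \<Longrightarrow> \<phi> (x * y) = \<phi> x * \<phi> y"
proof -
  show add: "\<phi> (x + y) = \<phi> x + \<phi> y" if "x \<in> R" "y \<in> R" for x y
    using assms(2) that by (auto simp: ring_hom_on_def)
  show "\<phi> 1 = 1" "x \<in> R \<Longrightarrow> y \<in> R \<Longrightarrow> \<phi> (x * y) = \<phi> x * \<phi> y"
    using assms(2) by (auto simp: ring_hom_on_def)
  show "\<phi> 0 = 0" using add[of 0 0] subring_closed(1)[OF assms(1)] by simp
qed

lemma ring_hom_on_sum:
  assumes "is_subring R" "ring_hom_on R \<phi>" "\<And>i. i \<in> I \<Longrightarrow> f i \<in> R"
  shows "\<phi> (sum f I) = (\<Sum>i\<in>I. \<phi> (f i))"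
  using assms(3)
  by (induction I rule: infinite_finite_induct)
     (simp_all add: ring_hom_on_simps[OF assms(1,2)] subring_sum[OF assms(1)])

lemma ring_hom_on_power:
  assumes "is_subring R" "ring_hom_on R \<phi>" "x \<in> R"
  shows "\<phi> (x ^ n) = \<phi> x ^ n"
  by (induction n)
     (simp_all add: ring_hom_on_simps[OF assms(1,2)] subring_power[OF assms(1)] assms(3))


section \<open>Polynomials with coefficients in a subring\<close>

definition polys_over :: "'r::comm_ring_1 set \<Rightarrow> 'r poly set"
  where "polys_over R = {p. \<forall>n. coeff p n \<in> R}"

lemma polys_over_closed:
  assumes "is_subring R"
  shows "p \<in> polys_over R \<Longrightarrow> q \<in> polys_over R \<Longrightarrow> p + q \<in> polys_over R"
    "p \<in> polys_over R \<Longrightarrow> q \<in> polys_over R \<Longrightarrow> p - q \<in> polys_over R"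
    "p \<in> polys_over R \<Longrightarrow> q \<in> polys_over R \<Longrightarrow> p * q \<in> polys_over R"
    "c \<in> R \<Longrightarrow> p \<in> polys_over R \<Longrightarrow> smult c p \<in> polys_over R"
    "c \<in> R \<Longrightarrow> monom c n \<in> polys_over R"
    "c \<in> R \<Longrightarrow> [:c:] \<in> polys_over R"
    "0 \<in> polys_over R"
  by (auto simp: polys_over_def coeff_mult coeff_pCons subring_closed[OF assms]
        intro!: subring_sum[OF assms] split: nat.split)

lemma map_poly_hom_on:
  assumes R: "is_subring R" and \<phi>: "ring_hom_on R \<phi>"
    and "p \<in> polys_over R" "q \<in> polys_over R"
  shows "map_poly \<phi> (p + q) = map_poly \<phi> p + map_poly \<phi> q"
    "map_poly \<phi> (p * q) = map_poly \<phi> p * map_poly \<phi> q"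
    "c \<in> R \<Longrightarrow> map_poly \<phi> (smult c p) = smult (\<phi> c) (map_poly \<phi> p)"
  using assms(3,4)
  by (auto simp: poly_eq_iff coeff_map_poly coeff_mult polys_over_def ring_hom_on_simps[OF R \<phi>]
        ring_hom_on_sum[OF R \<phi>] subring_closed[OF R])

text \<open>Division by \<open>f\<close> with remainder would divide by the leading coefficient of \<open>f\<close>, which need not be
invertible in \<open>R\<close>. Multiplying by it before each reduction step keeps quotient and remainder over
\<open>R\<close>.\<close>

lemma pseudo_division_over:
  fixes f g :: "'r::idom poly"
  assumes R: "is_subring R" and f: "f \<in> polys_over R" "f \<noteq> 0" and g: "g \<in> polys_over R"
  shows "\<exists>k. \<exists>q\<in>polys_over R. \<exists>r\<in>polys_over R.
    smult (lead_coeff f ^ k) g = q * f + r \<and> (r = 0 \<or> degree r < degree f)"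
  using g
proof (induction "degree g" arbitrary: g rule: less_induct)
  case less
  show ?case
  proof (cases "g = 0 \<or> degree g < degree f")
    case True
    then show ?thesis using less.prems
      by (intro exI[of _ 0] bexI[of _ 0] bexI[of _ g]) (auto simp: polys_over_closed[OF R])
  next
    case False
    let ?c = "lead_coeff f"
    define s where "s = monom (lead_coeff g) (degree g - degree f)"
    define g' where "g' = smult ?c g - s * f"
    have cR: "?c \<in> R" "lead_coeff g \<in> R" using f less.prems by (auto simp: polys_over_def)
    have s: "s \<in> polys_over R" by (simp add: s_def polys_over_closed[OF R] cR)
    have g': "g' \<in> polys_over R"
      unfolding g'_def using cR s f less.prems by (intro polys_over_closed[OF R])
    have "s \<noteq> 0" using False by (simp add: s_def monom_eq_0_iff)
    moreover have ds: "degree s = degree g - degree f" using False unfolding s_def by (intro degree_monom_eq) auto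
    ultimately have "degree (s * f) = degree g"
      using f False degree_mult_eq[of s f] by auto
    then have deg: "degree g' \<le> degree g"
      unfolding g'_def by (intro degree_diff_le) (auto simp: degree_smult_le)
    have "coeff (s * f) (degree g) = lead_coeff (s * f)" by (simp add: \<open>degree (s * f) = degree g\<close>)
    also have "\<dots> = lead_coeff g * ?c" using ds by (simp add: lead_coeff_mult) (simp add: s_def)
    finally have top: "coeff g' (degree g) = 0" by (simp add: g'_def)
    show ?thesis
    proof (cases "g' = 0")
      case True
      then have "smult (?c ^ 1) g = s * f + 0" by (simp add: g'_def)
      then show ?thesis using s polys_over_closed(7)[OF R] by blast
    next
      case False
      then have "degree g' < degree g"
        using deg top by (metis leading_coeff_0_iff order_le_less)
      from less.hyps[OF this g'] obtain k q r where
        qr: "q \<in> polys_over R" "r \<in> polys_over R" "smult (?c ^ k) g' = q * f + r"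
          "r = 0 \<or> degree r < degree f" by blast
      have "smult (?c ^ Suc k) g = smult (?c ^ k) (g' + s * f)"
        by (simp add: g'_def mult.commute)
      also have "\<dots> = (q + smult (?c ^ k) s) * f + r"
        by (simp add: smult_add_right qr(3) ring_distribs)
      finally have "smult (?c ^ Suc k) g = (q + smult (?c ^ k) s) * f + r" .
      moreover have "q + smult (?c ^ k) s \<in> polys_over R"
        using qr(1) s cR by (intro polys_over_closed[OF R] subring_power[OF R])
      ultimately show ?thesis using qr(2,4) by blast
    qed
  qed
qed

definition adjoin :: "'r::comm_ring_1 set \<Rightarrow> 'r \<Rightarrow> 'r set"
  where "adjoin R x = (\<lambda>p. poly p x) ` polys_over R"

lemma subring_adjoin:
  assumes "is_subring R"
  shows "is_subring (adjoin R x)" "R \<subseteq> adjoin R x" "x \<in> adjoin R x"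
proof -
  note cl = polys_over_closed[OF assms]
  show "R \<subseteq> adjoin R x"
    unfolding adjoin_def using cl(6) by (force intro: image_eqI[of _ _ "[:_:]"])
  then have "1 \<in> adjoin R x" using subring_closed[OF assms] by blast
  then show "is_subring (adjoin R x)"
    using cl(2,3) by (auto simp: is_subring_def adjoin_def simp flip: poly_diff poly_mult)
  have "monom 1 1 \<in> polys_over R" by (simp add: cl subring_closed[OF assms])
  then show "x \<in> adjoin R x"
    unfolding adjoin_def by (force simp: poly_monom intro: image_eqI[of _ _ "monom 1 1"])
qed

text \<open>Sending \<open>x\<close> to \<open>\<xi>\<close> is consistent as soon as \<open>\<xi>\<close> satisfies the image under \<open>\<phi>\<close> of every algebraic
relation of \<open>x\<close> over \<open>R\<close>.\<close>

lemma ring_hom_on_adjoin: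
  fixes x :: "'r::comm_ring_1" and \<xi> :: "'s::comm_ring_1"
  assumes R: "is_subring R" and \<phi>: "ring_hom_on R \<phi>"
    and wd: "\<And>g. g \<in> polys_over R \<Longrightarrow> poly g x = 0 \<Longrightarrow> poly (map_poly \<phi> g) \<xi> = 0"
  obtains \<phi>' where "ring_hom_on (adjoin R x) \<phi>'"
    "\<And>g. g \<in> polys_over R \<Longrightarrow> \<phi>' (poly g x) = poly (map_poly \<phi> g) \<xi>"
proof -
  note cl = polys_over_closed[OF R] and mp = map_poly_hom_on[OF R \<phi>]
  define \<phi>' where "\<phi>' y = poly (map_poly \<phi> (SOME g. g \<in> polys_over R \<and> poly g x = y)) \<xi>" for y
  have eq: "\<phi>' (poly g x) = poly (map_poly \<phi> g) \<xi>" if g: "g \<in> polys_over R" for g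
  proof -
    define h where "h = (SOME h. h \<in> polys_over R \<and> poly h x = poly g x)"
    have "h \<in> polys_over R \<and> poly h x = poly g x"
      unfolding h_def by (rule someI[of _ g]) (use g in simp)
    then have h: "h \<in> polys_over R" "poly h x = poly g x" by auto
    then have "poly (map_poly \<phi> (h - g)) \<xi> = 0" by (intro wd) (auto simp: cl g)
    moreover have "map_poly \<phi> h = map_poly \<phi> (h - g) + map_poly \<phi> g"
      using mp(1)[of "h - g" g] h g by (simp add: cl)
    ultimately show ?thesis by (simp add: \<phi>'_def flip: h_def)
  qed
  have "[:1:] \<in> polys_over R" by (simp only: cl subring_closed[OF R])
  from eq[OF this] have "\<phi>' 1 = 1" by (simp add: map_poly_pCons ring_hom_on_simps[OF R \<phi>])
  moreover have "\<phi>' (poly p x + poly q x) = \<phi>' (poly p x) + \<phi>' (poly q x)"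
      "\<phi>' (poly p x * poly q x) = \<phi>' (poly p x) * \<phi>' (poly q x)"
    if "p \<in> polys_over R" "q \<in> polys_over R" for p q
    using eq[of "p + q"] eq[of "p * q"] that by (simp_all add: eq cl mp)
  ultimately have "ring_hom_on (adjoin R x) \<phi>'"
    by (auto simp: ring_hom_on_def adjoin_def)
  with eq that show ?thesis by blast
qed

section \<open>Specialisation of finitely generated subalgebras\<close>

text \<open>A nonconstant \<open>p\<close> takes the value \<open>1\<close>, namely at a root of \<open>p - 1\<close>.\<close>

lemma alg_closed_nonzero_value:
  fixes p :: "'k::alg_closed_field poly"
  assumes "p \<noteq> 0"
  shows "\<exists>\<xi>. poly p \<xi> \<noteq> 0"
proof (cases "degree p = 0")
  case True
  then show ?thesis using assms
    by (metis degree_eq_zeroE pCons_0_0 poly_pCons mult_zero_right add_0_right poly_0)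
next
  case False
  have "degree (p - 1) = degree p"
    using False degree_add_eq_left[of "-1" p] by simp
  then obtain \<xi> where "poly (p - 1) \<xi> = 0"
    using False alg_closed_imp_poly_has_root[of "p - 1"] by auto
  then show ?thesis by (intro exI[of _ \<xi>]) auto
qed

text \<open>Over the fraction field of \<open>R\<close>, \<open>v\<close> would simply be invertible because \<open>x\<close> is algebraic; clearing
denominators gives the claim. To stay inside \<open>R\<close>, take a polynomial \<open>f\<close> of least degree among those
whose value at \<open>x\<close> is a nonzero multiple of \<open>v\<close>. Reducing modulo the minimal relation \<open>p\<close> shows
\<open>degree f < degree p\<close>, and if \<open>f\<close> were not constant, dividing \<open>p\<close> by \<open>f\<close> would yield either a
smaller such \<open>f\<close> or a relation of \<open>x\<close> of smaller degree than \<open>p\<close>.\<close>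

lemma algebraic_divides_constant:
  fixes x :: "'f::idom"
  assumes R: "is_subring R"
    and p: "p \<in> polys_over R" "p \<noteq> 0" "poly p x = 0"
    and p_min: "\<And>q. q \<in> polys_over R \<Longrightarrow> q \<noteq> 0 \<Longrightarrow> poly q x = 0 \<Longrightarrow> degree p \<le> degree q"
    and v: "v \<in> adjoin R x" "v \<noteq> 0"
  shows "\<exists>b\<in>R. \<exists>w\<in>adjoin R x. b \<noteq> 0 \<and> b = v * w"
proof -
  note cl = polys_over_closed[OF R] and Rx = subring_adjoin[OF R, of x]
  define I where "I f \<longleftrightarrow> f \<in> polys_over R \<and> poly f x \<noteq> 0 \<and> (\<exists>w\<in>adjoin R x. poly f x = v * w)" for f
  obtain g where "g \<in> polys_over R" "v = poly g x" using v by (auto simp: adjoin_def)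
  then have "I g" using v subring_closed(2)[OF Rx(1)] by (auto simp: I_def)
  then obtain f where f: "I f" and f_min: "\<And>h. I h \<Longrightarrow> degree f \<le> degree h"
    using ex_has_least_nat[of I g degree] by blast
  from f obtain w where fR: "f \<in> polys_over R" and fx: "poly f x \<noteq> 0"
    and w: "w \<in> adjoin R x" "poly f x = v * w" by (auto simp: I_def)
  have f0: "f \<noteq> 0" using fx by auto
  have lp: "lead_coeff p \<in> R" and lf: "lead_coeff f \<in> R" using p fR by (auto simp: polys_over_def)
  \<comment> \<open>The remainder of \<open>f\<close> modulo \<open>p\<close> has, up to a nonzero factor from \<open>R\<close>, the same value at \<open>x\<close>.\<close>
  have less: "degree f < degree p"
  proof -
    obtain k q r where r: "q \<in> polys_over R" "r \<in> polys_over R"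
        "smult (lead_coeff p ^ k) f = q * p + r" "r = 0 \<or> degree r < degree p"
      using pseudo_division_over[OF R p(1,2) fR] by blast
    from arg_cong[OF r(3), of "\<lambda>h. poly h x"] have rx: "poly r x = lead_coeff p ^ k * poly f x"
      by (simp add: p)
    then have "poly r x \<noteq> 0" using p fx by simp
    moreover have "poly r x = v * (lead_coeff p ^ k * w)" by (simp add: rx w)
    moreover have "lead_coeff p ^ k * w \<in> adjoin R x"
      using Rx(2) lp w by (intro subring_closed(4)[OF Rx(1)] subring_power[OF Rx(1)]) auto
    ultimately have "I r" using r by (auto simp: I_def)
    from f_min[OF this] r(4) \<open>poly r x \<noteq> 0\<close> show ?thesis by auto
  qed
  have "degree f = 0"
  proof (rule ccontr)
    assume df: "degree f \<noteq> 0"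
    obtain k q r where r: "q \<in> polys_over R" "r \<in> polys_over R"
        "smult (lead_coeff f ^ k) p = q * f + r" "r = 0 \<or> degree r < degree f"
      using pseudo_division_over[OF R fR f0 p(1)] by blast
    from arg_cong[OF r(3), of "\<lambda>h. poly h x"] have "poly r x = - poly q x * poly f x"
      by (simp add: p eq_neg_iff_add_eq_0 add.commute)
    then have rx: "poly r x = v * ((0 - poly q x) * w)" by (simp add: w)
    have "poly q x \<in> adjoin R x" using r by (auto simp: adjoin_def)
    then have "(0 - poly q x) * w \<in> adjoin R x"
      using w by (intro subring_closed[OF Rx(1)])
    \<comment> \<open>The remainder of \<open>p\<close> modulo \<open>f\<close> has a multiple of \<open>v\<close> as its value, so minimality of \<open>f\<close> applies.\<close>
    have "poly r x = 0"
    proof (rule ccontr)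
      assume "poly r x \<noteq> 0"
      then have "I r" unfolding I_def using r(2) rx \<open>(0 - poly q x) * w \<in> adjoin R x\<close> by blast
      from f_min[OF this] r(4) \<open>poly r x \<noteq> 0\<close> show False by auto
    qed
    then have "r = 0" using p_min[of r] r less by force
    \<comment> \<open>Hence \<open>x\<close> is a root of the cofactor \<open>q\<close>, whose degree is too small.\<close>
    with r(3) have fac: "smult (lead_coeff f ^ k) p = q * f" by simp
    have "lead_coeff f ^ k \<noteq> 0" using f0 by simp
    then have "q \<noteq> 0" using fac p by auto
    have "poly q x * poly f x = 0" using arg_cong[OF fac, of "\<lambda>h. poly h x"] p by simp
    then have "degree p \<le> degree q" using fx p_min[of q] r \<open>q \<noteq> 0\<close> by simp
    moreover have "degree p = degree q + degree f"
      using arg_cong[OF fac, of degree] \<open>q \<noteq> 0\<close> f0 \<open>lead_coeff f ^ k \<noteq> 0\<close> by (simp add: degree_mult_eq)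
    ultimately show False using df by simp
  qed
  then have "poly f x = lead_coeff f" by (metis degree_eq_zeroE poly_const_conv coeff_pCons_0)
  then show ?thesis using lf fx w by metis
qed

text \<open>The extension theorem for homomorphisms into an algebraically closed field. If \<open>x\<close> is transcendental
over \<open>R\<close>, any \<open>\<xi>\<close> may be chosen as the image of \<open>x\<close>; writing \<open>v\<close> as a polynomial in \<open>x\<close> with leading
coefficient \<open>u\<close>, some \<open>\<xi>\<close> keeps the image of \<open>v\<close> nonzero, because the image of this polynomial is
nonzero when \<open>\<phi> u \<noteq> 0\<close>. If \<open>x\<close> is algebraic with minimal relation
\<open>p\<close>, the image of \<open>x\<close> must be a root of the image of \<open>p\<close>. When the leading coefficient of \<open>p\<close> does not
vanish under \<open>\<phi>\<close>, such a root exists, and it satisfies all other relations too, since \<open>p\<close> divides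
them up to a power of that coefficient. Finally \<open>v\<close> cannot vanish if a nonzero constant that it
divides does not.

The element \<open>v\<close> is carried along only so that this step can be iterated: the condition
\<open>\<phi> u \<noteq> 0\<close> at one stage is what the previous stage has to guarantee.\<close>

lemma specialisation_step:
  fixes x :: "'f::field"
  assumes R: "is_subring R" and v: "v \<in> adjoin R x" "v \<noteq> 0"
  shows "\<exists>u\<in>R. u \<noteq> 0 \<and> (\<forall>\<phi> :: 'f \<Rightarrow> 'k::alg_closed_field. ring_hom_on R \<phi> \<and> \<phi> u \<noteq> 0 \<longrightarrow>
    (\<exists>\<phi>'. ring_hom_on (adjoin R x) \<phi>' \<and> (\<forall>y\<in>R. \<phi>' y = \<phi> y) \<and> \<phi>' v \<noteq> 0))"
proof -
  note cl = polys_over_closed[OF R]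
  have agree: "\<phi>' y = \<phi> y"
    if \<phi>: "ring_hom_on R \<phi>" and ext: "\<And>g. g \<in> polys_over R \<Longrightarrow> \<phi>' (poly g x) = poly (map_poly \<phi> g) \<xi>"
      and "y \<in> R" for \<phi> \<phi>' :: "'f \<Rightarrow> 'k" and y \<xi>
    using ext[OF cl(6)[OF that(3)]] by (simp add: map_poly_pCons ring_hom_on_simps[OF R \<phi>])
  show ?thesis
  proof (cases "\<exists>p\<in>polys_over R. p \<noteq> 0 \<and> poly p x = 0")
    case False
    obtain g where g: "g \<in> polys_over R" "v = poly g x" using v by (auto simp: adjoin_def)
    then have "lead_coeff g \<in> R" "lead_coeff g \<noteq> 0" using v by (auto simp: polys_over_def)
    moreover have "\<exists>\<phi>'. ring_hom_on (adjoin R x) \<phi>' \<and> (\<forall>y\<in>R. \<phi>' y = \<phi> y) \<and> \<phi>' v \<noteq> 0"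
      if \<phi>: "ring_hom_on R \<phi>" and nz: "\<phi> (lead_coeff g) \<noteq> 0" for \<phi> :: "'f \<Rightarrow> 'k"
    proof -
      have "coeff (map_poly \<phi> g) (degree g) \<noteq> 0"
        using nz by (simp add: coeff_map_poly ring_hom_on_simps[OF R \<phi>])
      then obtain \<xi> where \<xi>: "poly (map_poly \<phi> g) \<xi> \<noteq> 0"
        using alg_closed_nonzero_value[of "map_poly \<phi> g"] by force
      have "poly (map_poly \<phi> h) \<xi> = 0" if "h \<in> polys_over R" "poly h x = 0" for h
        using False that by auto
      then obtain \<phi>' where "ring_hom_on (adjoin R x) \<phi>'"
          and ext: "\<And>g. g \<in> polys_over R \<Longrightarrow> \<phi>' (poly g x) = poly (map_poly \<phi> g) \<xi>"
        using ring_hom_on_adjoin[OF R \<phi>] by blast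
      moreover have "\<phi>' v \<noteq> 0" using ext[OF g(1)] g(2) \<xi> by simp
      ultimately show ?thesis using agree[OF \<phi> ext] by blast
    qed
    ultimately show ?thesis by blast
  next
    case True
    then obtain p0 where "p0 \<in> polys_over R \<and> p0 \<noteq> 0 \<and> poly p0 x = 0" by blast
    then have "\<exists>p. (p \<in> polys_over R \<and> p \<noteq> 0 \<and> poly p x = 0) \<and>
        (\<forall>q. q \<in> polys_over R \<and> q \<noteq> 0 \<and> poly q x = 0 \<longrightarrow> degree p \<le> degree q)"
      by (rule ex_has_least_nat)
    then obtain p where p: "p \<in> polys_over R" "p \<noteq> 0" "poly p x = 0"
      and "\<forall>q. q \<in> polys_over R \<and> q \<noteq> 0 \<and> poly q x = 0 \<longrightarrow> degree p \<le> degree q" by auto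
    then have p_min: "degree p \<le> degree q" if "q \<in> polys_over R" "q \<noteq> 0" "poly q x = 0" for q
      using that by auto
    have "\<exists>b\<in>R. \<exists>w\<in>adjoin R x. b \<noteq> 0 \<and> b = v * w"
      by (rule algebraic_divides_constant[OF R p p_min v])
    then obtain b w where b: "b \<in> R" "w \<in> adjoin R x" "b \<noteq> 0" "b = v * w" by blast
    let ?a = "lead_coeff p"
    have a: "?a \<in> R" "?a \<noteq> 0" using p by (auto simp: polys_over_def)
    have "degree p \<noteq> 0" using p by (metis degree_eq_zeroE poly_const_conv pCons_0_0)
    have "\<exists>\<phi>'. ring_hom_on (adjoin R x) \<phi>' \<and> (\<forall>y\<in>R. \<phi>' y = \<phi> y) \<and> \<phi>' v \<noteq> 0"
      if \<phi>: "ring_hom_on R \<phi>" and nz: "\<phi> (?a * b) \<noteq> 0" for \<phi> :: "'f \<Rightarrow> 'k"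
    proof -
      note hom = ring_hom_on_simps[OF R \<phi>]
      have nz': "\<phi> ?a \<noteq> 0" "\<phi> b \<noteq> 0" using nz a b by (auto simp: hom)
      have "coeff (map_poly \<phi> p) (degree p) \<noteq> 0" using nz' by (simp add: coeff_map_poly hom)
      then have "degree (map_poly \<phi> p) > 0" using le_degree \<open>degree p \<noteq> 0\<close> by fastforce
      then obtain \<xi> where \<xi>: "poly (map_poly \<phi> p) \<xi> = 0"
        using alg_closed_imp_poly_has_root by blast
      have "poly (map_poly \<phi> g) \<xi> = 0" if g: "g \<in> polys_over R" "poly g x = 0" for g
      proof -
        obtain k q r where r: "q \<in> polys_over R" "r \<in> polys_over R"
            "smult (?a ^ k) g = q * p + r" "r = 0 \<or> degree r < degree p"
          using pseudo_division_over[OF R p(1,2) g(1)] by blast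
        from arg_cong[OF r(3), of "\<lambda>h. poly h x"] have "poly r x = 0" by (simp add: p g)
        then have "r = 0" using r p_min[of r] by force
        with r(3) have "map_poly \<phi> (smult (?a ^ k) g) = map_poly \<phi> (q * p)" by simp
        then have "smult (\<phi> ?a ^ k) (map_poly \<phi> g) = map_poly \<phi> q * map_poly \<phi> p"
          using g(1) r(1) p(1) a(1)
          by (simp only: map_poly_hom_on[OF R \<phi>] subring_power[OF R] ring_hom_on_power[OF R \<phi>])
        from arg_cong[OF this, of "\<lambda>h. poly h \<xi>"] show ?thesis using \<xi> nz' by simp
      qed
      then obtain \<phi>' where \<phi>': "ring_hom_on (adjoin R x) \<phi>'"
          and ext: "\<And>g. g \<in> polys_over R \<Longrightarrow> \<phi>' (poly g x) = poly (map_poly \<phi> g) \<xi>"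
        using ring_hom_on_adjoin[OF R \<phi>] by blast
      have "\<phi>' b = \<phi>' v * \<phi>' w"
        using ring_hom_on_simps(4)[OF subring_adjoin(1)[OF R] \<phi>' v(1) b(2)] b(4) by simp
      moreover have "\<phi>' b = \<phi> b" using agree[OF \<phi> ext b(1)] .
      ultimately have "\<phi>' v \<noteq> 0" using nz' by auto
      then show ?thesis using \<phi>' agree[OF \<phi> ext] by blast
    qed
    moreover have "?a * b \<in> R" "?a * b \<noteq> 0" using a b subring_closed[OF R] by auto
    ultimately show ?thesis by blast
  qed
qed

context field_extension
begin

lemma map_zero: "\<iota> 0 = 0"
  using map_add[of 0 0] by (metis add.right_neutral add_left_imp_eq)

lemma map_minus: "\<iota> (x - y) = \<iota> x - \<iota> y"
  using map_add[of "x - y" y] by (simp add: algebra_simps)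

lemma map_eq_0_iff: "\<iota> x = 0 \<longleftrightarrow> x = 0"
  using map_mult[of x "inverse x"] map_one map_zero by (cases "x = 0") auto

lemma inj_map: "inj \<iota>"
  by (rule injI) (metis map_minus map_eq_0_iff eq_iff_diff_eq_0)

lemma subring_range: "is_subring (range \<iota>)"
  unfolding is_subring_def
  by (auto simp flip: map_minus map_mult) (metis map_one rangeI)

end

text \<open>A form of the weak Nullstellensatz, with \<open>\<phi>\<close> as the \<open>K\<close>-rational point. The induction adjoins the
elements of \<open>X\<close> to the image of \<open>K\<close> one by one and provides, at each stage, a homomorphism that does
not vanish at a prescribed nonzero \<open>v\<close>; at the end, \<open>v = 1\<close>.\<close>

theorem specialisation:
  fixes \<iota> :: "'k::alg_closed_field \<Rightarrow> 'f::field"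
  assumes "field_extension \<iota>" and "finite X"
  obtains R and \<phi> :: "'f \<Rightarrow> 'k" where "is_subring R" "range \<iota> \<subseteq> R" "X \<subseteq> R"
    "ring_hom_on R \<phi>" "\<And>c. \<phi> (\<iota> c) = c"
proof -
  interpret field_extension \<iota> by fact
  have "\<exists>R. is_subring R \<and> range \<iota> \<subseteq> R \<and> X \<subseteq> R \<and>
    (\<forall>v\<in>R. v \<noteq> 0 \<longrightarrow> (\<exists>\<phi> :: 'f \<Rightarrow> 'k. ring_hom_on R \<phi> \<and> (\<forall>c. \<phi> (\<iota> c) = c) \<and> \<phi> v \<noteq> 0))"
    using assms(2)
  proof (induction X rule: finite_induct)
    case empty
    \<comment> \<open>\<open>inv \<iota>\<close> identifies the image of \<open>K\<close> in \<open>F\<close> with \<open>K\<close>.\<close>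
    have inv: "inv \<iota> (\<iota> c) = c" for c by (simp add: inj_map)
    have "inv \<iota> 1 = 1" using inv[of 1] by (simp add: map_one)
    then have "ring_hom_on (range \<iota>) (inv \<iota>)"
      by (auto simp: ring_hom_on_def inv simp flip: map_add map_mult)
    then show ?case using subring_range inv map_zero
      by (intro exI[of _ "range \<iota>"]) (auto intro!: exI[of _ "inv \<iota>"])
  next
    case (insert x X)
    then obtain R where R: "is_subring R" "range \<iota> \<subseteq> R" "X \<subseteq> R"
      and hom: "\<And>v. v \<in> R \<Longrightarrow> v \<noteq> 0 \<Longrightarrow>
        \<exists>\<phi> :: 'f \<Rightarrow> 'k. ring_hom_on R \<phi> \<and> (\<forall>c. \<phi> (\<iota> c) = c) \<and> \<phi> v \<noteq> 0" by blast
    have "\<exists>\<phi> :: 'f \<Rightarrow> 'k. ring_hom_on (adjoin R x) \<phi> \<and> (\<forall>c. \<phi> (\<iota> c) = c) \<and> \<phi> v \<noteq> 0"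
      if v: "v \<in> adjoin R x" "v \<noteq> 0" for v
    proof -
      obtain u where u: "u \<in> R" "u \<noteq> 0"
        and ext: "\<And>\<phi> :: 'f \<Rightarrow> 'k. ring_hom_on R \<phi> \<Longrightarrow> \<phi> u \<noteq> 0 \<Longrightarrow>
          \<exists>\<phi>'. ring_hom_on (adjoin R x) \<phi>' \<and> (\<forall>y\<in>R. \<phi>' y = \<phi> y) \<and> \<phi>' v \<noteq> 0"
        using specialisation_step[OF R(1) v] by metis
      obtain \<phi> :: "'f \<Rightarrow> 'k" where \<phi>: "ring_hom_on R \<phi>" "\<And>c. \<phi> (\<iota> c) = c" "\<phi> u \<noteq> 0"
        using hom[OF u] by blast
      obtain \<phi>' where \<phi>': "ring_hom_on (adjoin R x) \<phi>'" "\<forall>y\<in>R. \<phi>' y = \<phi> y" "\<phi>' v \<noteq> 0"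
        using ext[OF \<phi>(1,3)] by blast
      have "\<phi>' (\<iota> c) = c" for c using \<phi>'(2) \<phi>(2)[of c] R(2) by (metis range_subsetD)
      then show ?thesis using \<phi>' by blast
    qed
    then show ?case using subring_adjoin[OF R(1), of x] R
      by (intro exI[of _ "adjoin R x"]) auto
  qed
  then obtain R where R: "is_subring R" "range \<iota> \<subseteq> R" "X \<subseteq> R"
    and hom: "\<And>v. v \<in> R \<Longrightarrow> v \<noteq> 0 \<Longrightarrow> \<exists>\<phi> :: 'f \<Rightarrow> 'k. ring_hom_on R \<phi> \<and> (\<forall>c. \<phi> (\<iota> c) = c) \<and> \<phi> v \<noteq> 0"
    by blast
  from hom[OF subring_closed(2)[OF R(1)]] that R show ?thesis by auto
qed


section \<open>Isomorphisms of algebras given by carriers\<close>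

text \<open>The records do not require the operations to preserve the carrier, and without this the inverse of an
isomorphism need not be one.\<close>

definition closed_operations :: "('k, 'v) algebra_data \<Rightarrow> bool"
  where "closed_operations V \<longleftrightarrow>
    (\<forall>x\<in>alg_carrier V. \<forall>y\<in>alg_carrier V. alg_add V x y \<in> alg_carrier V) \<and>
    (\<forall>c. \<forall>x\<in>alg_carrier V. alg_smult V c x \<in> alg_carrier V) \<and>
    (\<forall>x\<in>alg_carrier V. \<forall>y\<in>alg_carrier V. alg_mult V x y \<in> alg_carrier V)"

lemma algebra_iso_inv_into:
  assumes "closed_operations V" "algebra_iso V W \<phi>"
  shows "algebra_iso W V (inv_into (alg_carrier V) \<phi>)"
proof -
  let ?\<psi> = "inv_into (alg_carrier V) \<phi>"
  have bij: "bij_betw \<phi> (alg_carrier V) (alg_carrier W)"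
    using assms by (simp add: algebra_iso_def)
  note inv = bij_betw_inv_into_left[OF bij]
  have W: "\<exists>x'\<in>alg_carrier V. x = \<phi> x'" if "x \<in> alg_carrier W" for x
    using bij that by (auto simp: bij_betw_def)
  have \<phi>: "alg_add W (\<phi> x) (\<phi> y) = \<phi> (alg_add V x y)" "alg_smult W c (\<phi> x) = \<phi> (alg_smult V c x)"
    "alg_mult W (\<phi> x) (\<phi> y) = \<phi> (alg_mult V x y)"
    if "x \<in> alg_carrier V" "y \<in> alg_carrier V" for x y c
    using assms(2) that by (auto simp: algebra_iso_def)
  have cl: "alg_add V x y \<in> alg_carrier V" "alg_smult V c x \<in> alg_carrier V"
    "alg_mult V x y \<in> alg_carrier V"
    if "x \<in> alg_carrier V" "y \<in> alg_carrier V" for x y c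
    using assms(1) that by (auto simp: closed_operations_def)
  have "?\<psi> (alg_add W x y) = alg_add V (?\<psi> x) (?\<psi> y)" "?\<psi> (alg_smult W c x) = alg_smult V c (?\<psi> x)"
    "?\<psi> (alg_mult W x y) = alg_mult V (?\<psi> x) (?\<psi> y)"
    if xy: "x \<in> alg_carrier W" "y \<in> alg_carrier W" for x y c
  proof -
    obtain x' y' where "x' \<in> alg_carrier V" "x = \<phi> x'" "y' \<in> alg_carrier V" "y = \<phi> y'"
      using W xy by metis
    then show "?\<psi> (alg_add W x y) = alg_add V (?\<psi> x) (?\<psi> y)"
      "?\<psi> (alg_smult W c x) = alg_smult V c (?\<psi> x)"
      "?\<psi> (alg_mult W x y) = alg_mult V (?\<psi> x) (?\<psi> y)"
      by (simp_all add: \<phi> cl inv)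
  qed
  then show ?thesis
    using bij_betw_inv_into[OF bij] by (simp add: algebra_iso_def)
qed

lemma algebra_isomorphic_sym:
  "closed_operations V \<Longrightarrow> algebra_isomorphic V W \<Longrightarrow> algebra_isomorphic W V"
  unfolding algebra_isomorphic_def using algebra_iso_inv_into by blast

lemma algebra_isomorphic_trans:
  assumes "algebra_isomorphic U V" "algebra_isomorphic V W"
  shows "algebra_isomorphic U W"
proof -
  obtain \<phi> \<psi> where iso: "algebra_iso U V \<phi>" "algebra_iso V W \<psi>"
    using assms by (auto simp: algebra_isomorphic_def)
  have "\<phi> x \<in> alg_carrier V" if "x \<in> alg_carrier U" for x
    using iso(1) that by (auto simp: algebra_iso_def bij_betw_def)
  then have "algebra_iso U W (\<psi> \<circ> \<phi>)"
    using iso unfolding algebra_iso_def by (auto intro: bij_betw_trans)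
  then show ?thesis by (auto simp: algebra_isomorphic_def)
qed

lemma algebra_isomorphic_cong:
  assumes "closed_operations V" "closed_operations V'"
    and "algebra_isomorphic V W" "algebra_isomorphic V' W'"
  shows "algebra_isomorphic V V' \<longleftrightarrow> algebra_isomorphic W W'"
proof
  assume "algebra_isomorphic V V'"
  then show "algebra_isomorphic W W'"
    using assms by (meson algebra_isomorphic_sym algebra_isomorphic_trans)
next
  assume "algebra_isomorphic W W'"
  then have "algebra_isomorphic V W'"
    using assms by (meson algebra_isomorphic_trans)
  then show "algebra_isomorphic V V'"
    using assms by (meson algebra_isomorphic_sym algebra_isomorphic_trans)
qed


section \<open>Algebras given by structure constants\<close>

text \<open>The algebra with basis \<open>S\<close> and product \<open>i \<cdot> j = \<Sum>k. \<gamma> i j k \<cdot> k\<close>. Vectors are coordinate functions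
extended by \<open>0\<close> outside \<open>S\<close>, so that equality of functions is equality of vectors.\<close>

definition coord_algebra :: "'i set \<Rightarrow> ('i \<Rightarrow> 'i \<Rightarrow> 'i \<Rightarrow> 'f) \<Rightarrow> ('f::field, 'i \<Rightarrow> 'f) algebra_data"
  where "coord_algebra S \<gamma> =
    \<lparr>alg_carrier = {f. \<forall>i. i \<notin> S \<longrightarrow> f i = 0},
     alg_add = (\<lambda>f g i. f i + g i),
     alg_smult = (\<lambda>c f i. c * f i),
     alg_mult = (\<lambda>f g k. if k \<in> S then \<Sum>i\<in>S. \<Sum>j\<in>S. f i * g j * \<gamma> i j k else 0)\<rparr>"

lemma closed_coord_algebra: "closed_operations (coord_algebra S \<gamma>)"
  by (simp add: closed_operations_def coord_algebra_def)

text \<open>\<open>P\<close> and \<open>Q\<close> are mutually inverse matrices, and \<open>P\<close> turns the products \<open>\<gamma>\<close> of basis vectors into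
the products \<open>\<delta>\<close>. Naming the inverse matrix makes the whole condition a system of polynomial
equations in the entries of \<open>P\<close> and \<open>Q\<close>, with no inequation on a determinant; this is why it is
preserved by ring homomorphisms.\<close>

definition change_of_basis :: "'i set \<Rightarrow> ('i \<Rightarrow> 'i \<Rightarrow> 'i \<Rightarrow> 'f) \<Rightarrow> 'j set \<Rightarrow> ('j \<Rightarrow> 'j \<Rightarrow> 'j \<Rightarrow> 'f) \<Rightarrow>
    ('i \<Rightarrow> 'j \<Rightarrow> 'f::comm_ring_1) \<Rightarrow> ('j \<Rightarrow> 'i \<Rightarrow> 'f) \<Rightarrow> bool"
  where "change_of_basis S \<gamma> T \<delta> P Q \<longleftrightarrow>
    (\<forall>i\<in>S. \<forall>i'\<in>S. (\<Sum>j\<in>T. P i j * Q j i') = (if i = i' then 1 else 0)) \<and>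
    (\<forall>j\<in>T. \<forall>j'\<in>T. (\<Sum>i\<in>S. Q j i * P i j') = (if j = j' then 1 else 0)) \<and>
    (\<forall>i\<in>S. \<forall>i'\<in>S. \<forall>l\<in>T.
      (\<Sum>k\<in>S. \<gamma> i i' k * P k l) = (\<Sum>j\<in>T. \<Sum>j'\<in>T. P i j * P i' j' * \<delta> j j' l))"

lemma algebra_iso_matrix:
  fixes \<gamma> :: "'i \<Rightarrow> 'i \<Rightarrow> 'i \<Rightarrow> 'f::field"
  assumes "finite S" and iso: "algebra_iso (coord_algebra S \<gamma>) (coord_algebra T \<delta>) \<phi>"
    and f: "f \<in> alg_carrier (coord_algebra S \<gamma>)"
  shows "\<phi> f j = (\<Sum>i\<in>S. f i * \<phi> (\<lambda>i'. if i = i' then 1 else 0) j)"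
proof -
  let ?e = "\<lambda>i i'. if i = i' then 1 else (0::'f)"
  let ?C = "{f. \<forall>i. i \<notin> S \<longrightarrow> f i = (0::'f)}"
  have add: "\<phi> (\<lambda>i. f i + g i) = (\<lambda>j. \<phi> f j + \<phi> g j)" if "f \<in> ?C" "g \<in> ?C" for f g
    using iso that by (simp add: algebra_iso_def coord_algebra_def)
  have smult: "\<phi> (\<lambda>i. c * f i) = (\<lambda>j. c * \<phi> f j)" if "f \<in> ?C" for f c
    using iso that by (simp add: algebra_iso_def coord_algebra_def)
  \<comment> \<open>Linearity over finite sums, by adding one basis vector after another.\<close>
  have partial: "\<phi> (\<lambda>i. if i \<in> S' then f i else 0) j = (\<Sum>i\<in>S'. f i * \<phi> (?e i) j)"
    if "finite S'" "S' \<subseteq> S" for S' using that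
  proof (induction S' rule: finite_induct)
    case empty
    then show ?case using smult[of "\<lambda>_. 0" 0] by simp
  next
    case (insert k S')
    have "(\<lambda>i. if i \<in> insert k S' then f i else 0) = (\<lambda>i. f k * ?e k i + (if i \<in> S' then f i else 0))"
      using insert.hyps by auto
    moreover have "?e k \<in> ?C" "(\<lambda>i. f k * ?e k i) \<in> ?C" "(\<lambda>i. if i \<in> S' then f i else 0) \<in> ?C"
      using insert.prems by auto
    ultimately show ?case using insert by (simp only: add smult sum.insert) simp
  qed
  have "(\<lambda>i. if i \<in> S then f i else 0) = f"
    using f by (auto simp: coord_algebra_def)
  then show ?thesis using partial[OF assms(1) subset_refl] by simp
qed

lemma inverse_matrices_cancel:
  fixes f :: "'a \<Rightarrow> 'f::comm_ring_1"
  assumes "finite A" "a' \<in> A"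
    and "\<And>a. a \<in> A \<Longrightarrow> (\<Sum>b\<in>B. M a b * N b a') = (if a = a' then 1 else 0)"
  shows "(\<Sum>b\<in>B. (\<Sum>a\<in>A. f a * M a b) * N b a') = f a'"
proof -
  have "(\<Sum>b\<in>B. (\<Sum>a\<in>A. f a * M a b) * N b a') = (\<Sum>a\<in>A. f a * (\<Sum>b\<in>B. M a b * N b a'))"
    unfolding sum_distrib_right sum_distrib_left by (subst sum.swap) (simp only: mult.assoc)
  also have "\<dots> = (\<Sum>a\<in>A. if a = a' then f a else 0)"
    using assms(3) by (intro sum.cong) auto
  finally show ?thesis using assms(1,2) by simp
qed

lemma sum_swap_pairs:
  "(\<Sum>a\<in>A. \<Sum>b\<in>B. \<Sum>c\<in>C. \<Sum>d\<in>D. f a b c d) = (\<Sum>c\<in>C. \<Sum>d\<in>D. \<Sum>a\<in>A. \<Sum>b\<in>B. f a b c d)"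
proof -
  have "(\<Sum>a\<in>A. \<Sum>b\<in>B. \<Sum>c\<in>C. \<Sum>d\<in>D. f a b c d) = (\<Sum>a\<in>A. \<Sum>c\<in>C. \<Sum>b\<in>B. \<Sum>d\<in>D. f a b c d)"
    by (intro sum.cong[OF refl] sum.swap)
  also have "\<dots> = (\<Sum>c\<in>C. \<Sum>a\<in>A. \<Sum>b\<in>B. \<Sum>d\<in>D. f a b c d)"
    by (rule sum.swap)
  also have "\<dots> = (\<Sum>c\<in>C. \<Sum>a\<in>A. \<Sum>d\<in>D. \<Sum>b\<in>B. f a b c d)"
    by (intro sum.cong[OF refl] sum.swap)
  also have "\<dots> = (\<Sum>c\<in>C. \<Sum>d\<in>D. \<Sum>a\<in>A. \<Sum>b\<in>B. f a b c d)"
    by (intro sum.cong[OF refl] sum.swap)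
  finally show ?thesis .
qed

lemma change_of_basis_imp_isomorphic:
  fixes \<gamma> :: "'i \<Rightarrow> 'i \<Rightarrow> 'i \<Rightarrow> 'f::field" and \<delta> :: "'j \<Rightarrow> 'j \<Rightarrow> 'j \<Rightarrow> 'f"
  assumes fin: "finite S" "finite T" and cb: "change_of_basis S \<gamma> T \<delta> P Q"
  shows "algebra_isomorphic (coord_algebra S \<gamma>) (coord_algebra T \<delta>)"
proof -
  define \<phi> where "\<phi> f j = (if j \<in> T then \<Sum>i\<in>S. f i * P i j else 0)" for f j
  define \<psi> where "\<psi> g i = (if i \<in> S then \<Sum>j\<in>T. g j * Q j i else 0)" for g i
  have PQ: "(\<Sum>j\<in>T. P i j * Q j i') = (if i = i' then 1 else 0)" if "i \<in> S" "i' \<in> S" for i i'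
    using cb that by (auto simp: change_of_basis_def)
  have QP: "(\<Sum>i\<in>S. Q j i * P i j') = (if j = j' then 1 else 0)" if "j \<in> T" "j' \<in> T" for j j'
    using cb that by (auto simp: change_of_basis_def)
  have bij: "bij_betw \<phi> (alg_carrier (coord_algebra S \<gamma>)) (alg_carrier (coord_algebra T \<delta>))"
  proof (rule bij_betw_byWitness[where f' = \<psi>])
    show "\<forall>f\<in>alg_carrier (coord_algebra S \<gamma>). \<psi> (\<phi> f) = f"
      by (auto simp: coord_algebra_def \<phi>_def \<psi>_def fun_eq_iff PQ
          intro!: inverse_matrices_cancel[OF fin(1)] cong: sum.cong)
    show "\<forall>g\<in>alg_carrier (coord_algebra T \<delta>). \<phi> (\<psi> g) = g"
      by (auto simp: coord_algebra_def \<phi>_def \<psi>_def fun_eq_iff QP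
          intro!: inverse_matrices_cancel[OF fin(2)] cong: sum.cong)
  qed (auto simp: coord_algebra_def \<phi>_def \<psi>_def)
  have mult: "(\<Sum>k\<in>S. (\<Sum>i\<in>S. \<Sum>i'\<in>S. f i * g i' * \<gamma> i i' k) * P k l) =
      (\<Sum>j\<in>T. \<Sum>j'\<in>T. (\<Sum>i\<in>S. f i * P i j) * (\<Sum>i'\<in>S. g i' * P i' j') * \<delta> j j' l)"
    (is "?l = ?r") if l: "l \<in> T" for f g :: "'i \<Rightarrow> 'f" and l
  proof -
    have "?l = (\<Sum>k\<in>S. \<Sum>i\<in>S. \<Sum>i'\<in>S. f i * g i' * (\<gamma> i i' k * P k l))"
      by (simp only: sum_distrib_right mult.assoc)
    also have "\<dots> = (\<Sum>i\<in>S. \<Sum>k\<in>S. \<Sum>i'\<in>S. f i * g i' * (\<gamma> i i' k * P k l))"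
      by (rule sum.swap)
    also have "\<dots> = (\<Sum>i\<in>S. \<Sum>i'\<in>S. \<Sum>k\<in>S. f i * g i' * (\<gamma> i i' k * P k l))"
      by (intro sum.cong[OF refl] sum.swap)
    also have "\<dots> = (\<Sum>i\<in>S. \<Sum>i'\<in>S. f i * g i' * (\<Sum>k\<in>S. \<gamma> i i' k * P k l))"
      by (simp only: sum_distrib_left)
    also have "\<dots> = (\<Sum>i\<in>S. \<Sum>i'\<in>S. f i * g i' * (\<Sum>j\<in>T. \<Sum>j'\<in>T. P i j * P i' j' * \<delta> j j' l))"
      using cb l by (intro sum.cong refl) (auto simp: change_of_basis_def)
    also have "\<dots> = (\<Sum>i\<in>S. \<Sum>i'\<in>S. \<Sum>j\<in>T. \<Sum>j'\<in>T. f i * g i' * (P i j * P i' j' * \<delta> j j' l))"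
      by (simp only: sum_distrib_left)
    also have "\<dots> = (\<Sum>j\<in>T. \<Sum>j'\<in>T. \<Sum>i\<in>S. \<Sum>i'\<in>S. f i * g i' * (P i j * P i' j' * \<delta> j j' l))"
      by (rule sum_swap_pairs)
    also have "\<dots> = ?r"
      by (simp only: sum_product) (simp only: sum_distrib_right mult.assoc mult.left_commute)
    finally show ?thesis .
  qed
  have "algebra_iso (coord_algebra S \<gamma>) (coord_algebra T \<delta>) \<phi>"
    unfolding algebra_iso_def
  proof (intro conjI ballI allI bij)
    fix f g and c :: 'f
    show "\<phi> (alg_add (coord_algebra S \<gamma>) f g) = alg_add (coord_algebra T \<delta>) (\<phi> f) (\<phi> g)"
      by (auto simp: coord_algebra_def \<phi>_def fun_eq_iff ring_distribs sum.distrib)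
    show "\<phi> (alg_smult (coord_algebra S \<gamma>) c f) = alg_smult (coord_algebra T \<delta>) c (\<phi> f)"
      by (auto simp: coord_algebra_def \<phi>_def fun_eq_iff sum_distrib_left mult.assoc)
    show "\<phi> (alg_mult (coord_algebra S \<gamma>) f g) = alg_mult (coord_algebra T \<delta>) (\<phi> f) (\<phi> g)"
      using mult by (auto simp: coord_algebra_def \<phi>_def fun_eq_iff cong: sum.cong)
  qed
  then show ?thesis by (auto simp: algebra_isomorphic_def)
qed

text \<open>The rows of \<open>P\<close> and \<open>Q\<close> are the images of the unit vectors under the isomorphism and its inverse.\<close>

lemma isomorphic_imp_change_of_basis:
  fixes \<gamma> :: "'i \<Rightarrow> 'i \<Rightarrow> 'i \<Rightarrow> 'f::field" and \<delta> :: "'j \<Rightarrow> 'j \<Rightarrow> 'j \<Rightarrow> 'f"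
  assumes fin: "finite S" "finite T"
    and "algebra_isomorphic (coord_algebra S \<gamma>) (coord_algebra T \<delta>)"
  shows "\<exists>P Q. change_of_basis S \<gamma> T \<delta> P Q"
proof -
  let ?A = "coord_algebra S \<gamma>" and ?B = "coord_algebra T \<delta>"
  obtain \<phi> where \<phi>: "algebra_iso ?A ?B \<phi>" using assms by (auto simp: algebra_isomorphic_def)
  define \<psi> where "\<psi> = inv_into (alg_carrier ?A) \<phi>"
  have \<psi>: "algebra_iso ?B ?A \<psi>"
    unfolding \<psi>_def by (rule algebra_iso_inv_into[OF closed_coord_algebra \<phi>])
  have bij: "bij_betw \<phi> (alg_carrier ?A) (alg_carrier ?B)" using \<phi> by (simp add: algebra_iso_def)
  define e where "e i i' = (if i = i' then 1 else (0::'f))" for i i' :: 'i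
  define d where "d j j' = (if j = j' then 1 else (0::'f))" for j j' :: 'j
  define P where "P i = \<phi> (e i)" for i
  define Q where "Q j = \<psi> (d j)" for j
  have e: "e i \<in> alg_carrier ?A" if "i \<in> S" for i using that by (auto simp: coord_algebra_def e_def)
  have d: "d j \<in> alg_carrier ?B" if "j \<in> T" for j using that by (auto simp: coord_algebra_def d_def)
  have \<phi>_mat: "\<phi> f j = (\<Sum>i\<in>S. f i * P i j)" if "f \<in> alg_carrier ?A" for f j
    using algebra_iso_matrix[OF fin(1) \<phi> that] by (simp add: P_def e_def[abs_def])
  have \<psi>_mat: "\<psi> g i = (\<Sum>j\<in>T. g j * Q j i)" if "g \<in> alg_carrier ?B" for g i
    using algebra_iso_matrix[OF fin(2) \<psi> that] by (simp add: Q_def d_def[abs_def])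
  have PB: "P i \<in> alg_carrier ?B" if "i \<in> S" for i
    unfolding P_def using bij e[OF that] by (auto simp: bij_betw_def)
  have QA: "Q j \<in> alg_carrier ?A" if "j \<in> T" for j
    unfolding Q_def \<psi>_def using bij_betw_inv_into[OF bij] d[OF that] by (auto simp: bij_betw_def)
  have "(\<Sum>j\<in>T. P i j * Q j i') = (if i = i' then 1 else 0)" if "i \<in> S" for i i'
  proof -
    have "(\<Sum>j\<in>T. P i j * Q j i') = \<psi> (P i) i'" by (rule \<psi>_mat[OF PB[OF that], symmetric])
    also have "\<psi> (P i) = e i"
      unfolding P_def \<psi>_def by (rule bij_betw_inv_into_left[OF bij e[OF that]])
    finally show ?thesis by (simp add: e_def)
  qed
  moreover have "(\<Sum>i\<in>S. Q j i * P i j') = (if j = j' then 1 else 0)" if "j \<in> T" for j j'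
  proof -
    have "(\<Sum>i\<in>S. Q j i * P i j') = \<phi> (Q j) j'" by (rule \<phi>_mat[OF QA[OF that], symmetric])
    also have "\<phi> (Q j) = d j"
      unfolding Q_def \<psi>_def by (rule bij_betw_inv_into_right[OF bij d[OF that]])
    finally show ?thesis by (simp add: d_def)
  qed
  moreover have "(\<Sum>k\<in>S. \<gamma> i i' k * P k l) = (\<Sum>j\<in>T. \<Sum>j'\<in>T. P i j * P i' j' * \<delta> j j' l)"
    if i: "i \<in> S" "i' \<in> S" and l: "l \<in> T" for i i' l
  proof -
    have "(\<Sum>b\<in>S. e i a * e i' b * \<gamma> a b k) = (if i = a then \<gamma> a i' k else 0)" for a k
      using fin i by (simp add: e_def if_distrib[of "\<lambda>x. x * _"] cong: if_cong)
    then have "alg_mult ?A (e i) (e i') k = \<gamma> i i' k" if "k \<in> S" for k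
      using fin i that by (simp add: coord_algebra_def)
    then have "(\<Sum>k\<in>S. \<gamma> i i' k * P k l) = (\<Sum>k\<in>S. alg_mult ?A (e i) (e i') k * P k l)" by simp
    also have "\<dots> = \<phi> (alg_mult ?A (e i) (e i')) l"
      using closed_coord_algebra[of S \<gamma>] e i by (intro \<phi>_mat[symmetric]) (simp add: closed_operations_def)
    also have "\<phi> (alg_mult ?A (e i) (e i')) = alg_mult ?B (P i) (P i')"
      using \<phi> e i by (simp add: algebra_iso_def P_def)
    finally show ?thesis using l by (simp add: coord_algebra_def)
  qed
  ultimately show ?thesis unfolding change_of_basis_def by blast
qed

lemma isomorphic_iff_change_of_basis:
  "finite S \<Longrightarrow> finite T \<Longrightarrow>
    algebra_isomorphic (coord_algebra S \<gamma>) (coord_algebra T \<delta>) \<longleftrightarrow>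
    (\<exists>P Q. change_of_basis S \<gamma> T \<delta> P Q)"
  by (blast intro: change_of_basis_imp_isomorphic isomorphic_imp_change_of_basis)

section \<open>Descent of isomorphisms along the field extension\<close>

text \<open>Every equation in \<open>change_of_basis\<close> is polynomial with coefficients in the prime ring and in the
structure constants, so \<open>\<phi>\<close> maps solutions to solutions.\<close>

lemma change_of_basis_hom:
  assumes R: "is_subring R" and \<phi>: "ring_hom_on R \<phi>" and cb: "change_of_basis S \<gamma> T \<delta> P Q"
    and \<gamma>: "\<And>i i' k. \<gamma> i i' k \<in> R" and \<delta>: "\<And>j j' l. \<delta> j j' l \<in> R"
    and P: "\<And>i j. i \<in> S \<Longrightarrow> j \<in> T \<Longrightarrow> P i j \<in> R" and Q: "\<And>i j. i \<in> S \<Longrightarrow> j \<in> T \<Longrightarrow> Q j i \<in> R"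
  shows "change_of_basis S (\<lambda>i i' k. \<phi> (\<gamma> i i' k)) T (\<lambda>j j' l. \<phi> (\<delta> j j' l))
    (\<lambda>i j. \<phi> (P i j)) (\<lambda>j i. \<phi> (Q j i))"
proof -
  note hom = ring_hom_on_simps[OF R \<phi>] and cl = subring_closed[OF R]
  have dot: "(\<Sum>a\<in>A. \<phi> (f a) * \<phi> (g a)) = \<phi> (\<Sum>a\<in>A. f a * g a)"
    if "\<And>a. a \<in> A \<Longrightarrow> f a \<in> R" "\<And>a. a \<in> A \<Longrightarrow> g a \<in> R" for f g and A :: "'x set"
    using that by (simp add: ring_hom_on_sum[OF R \<phi>] hom cl)
  have "(\<Sum>j\<in>T. \<phi> (P i j) * \<phi> (Q j i')) = (if i = i' then 1 else 0)" if "i \<in> S" "i' \<in> S" for i i'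
    using cb that P Q by (simp add: dot change_of_basis_def hom)
  moreover have "(\<Sum>i\<in>S. \<phi> (Q j i) * \<phi> (P i j')) = (if j = j' then 1 else 0)"
    if "j \<in> T" "j' \<in> T" for j j'
    using cb that P Q by (simp add: dot change_of_basis_def hom)
  moreover have "(\<Sum>k\<in>S. \<phi> (\<gamma> i i' k) * \<phi> (P k l)) =
      (\<Sum>j\<in>T. \<Sum>j'\<in>T. \<phi> (P i j) * \<phi> (P i' j') * \<phi> (\<delta> j j' l))"
    if i: "i \<in> S" "i' \<in> S" and l: "l \<in> T" for i i' l
  proof -
    have "(\<Sum>k\<in>S. \<phi> (\<gamma> i i' k) * \<phi> (P k l)) = \<phi> (\<Sum>k\<in>S. \<gamma> i i' k * P k l)"
      using \<gamma> P l by (intro dot) auto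
    also have "\<dots> = \<phi> (\<Sum>j\<in>T. \<Sum>j'\<in>T. P i j * P i' j' * \<delta> j j' l)"
      using cb i l by (simp add: change_of_basis_def)
    also have "\<dots> = (\<Sum>j\<in>T. \<phi> (\<Sum>j'\<in>T. P i j * P i' j' * \<delta> j j' l))"
      using P i \<delta> by (intro ring_hom_on_sum[OF R \<phi>] subring_sum[OF R] cl) auto
    also have "\<dots> = (\<Sum>j\<in>T. \<Sum>j'\<in>T. \<phi> (P i j) * \<phi> (P i' j') * \<phi> (\<delta> j j' l))"
      using P i \<delta> by (intro sum.cong refl) (simp add: ring_hom_on_sum[OF R \<phi>] hom cl)
    finally show ?thesis .
  qed
  ultimately show ?thesis unfolding change_of_basis_def by blast
qed

text \<open>Solutions over \<open>K\<close> are mapped to \<open>F\<close> by \<open>\<iota>\<close>. Conversely, the entries of a solution over \<open>F\<close>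
generate a \<open>K\<close>-subalgebra of \<open>F\<close> that admits a homomorphism to \<open>K\<close>. It fixes the structure
constants, which lie in \<open>K\<close>, and carries the solution to one over \<open>K\<close>.\<close>

theorem change_of_basis_descends:
  fixes \<iota> :: "'k::alg_closed_field \<Rightarrow> 'f::field"
  assumes "field_extension \<iota>" and fin: "finite S" "finite T"
  shows "(\<exists>P Q. change_of_basis S (\<lambda>i i' k. \<iota> (\<gamma> i i' k)) T (\<lambda>j j' l. \<iota> (\<delta> j j' l)) P Q) \<longleftrightarrow>
    (\<exists>P Q. change_of_basis S \<gamma> T \<delta> P Q)"
proof
  assume "\<exists>P Q. change_of_basis S \<gamma> T \<delta> P Q"
  then obtain P Q where "change_of_basis S \<gamma> T \<delta> P Q" by blast
  moreover have "ring_hom_on UNIV \<iota>"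
    using assms(1) by (simp add: ring_hom_on_def field_extension_def)
  ultimately show "\<exists>P Q. change_of_basis S (\<lambda>i i' k. \<iota> (\<gamma> i i' k)) T (\<lambda>j j' l. \<iota> (\<delta> j j' l)) P Q"
    using change_of_basis_hom[of UNIV \<iota> S \<gamma> T \<delta> P Q] by (auto simp: is_subring_def)
next
  assume "\<exists>P Q. change_of_basis S (\<lambda>i i' k. \<iota> (\<gamma> i i' k)) T (\<lambda>j j' l. \<iota> (\<delta> j j' l)) P Q"
  then obtain P Q where
    cb: "change_of_basis S (\<lambda>i i' k. \<iota> (\<gamma> i i' k)) T (\<lambda>j j' l. \<iota> (\<delta> j j' l)) P Q" by blast
  let ?X = "(\<lambda>(i, j). P i j) ` (S \<times> T) \<union> (\<lambda>(i, j). Q j i) ` (S \<times> T)"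
  have "finite ?X" using fin by simp
  then obtain R and \<phi> :: "'f \<Rightarrow> 'k" where R: "is_subring R" "range \<iota> \<subseteq> R" "?X \<subseteq> R"
    and \<phi>: "ring_hom_on R \<phi>" "\<And>c. \<phi> (\<iota> c) = c"
    by (rule specialisation[OF assms(1)]) blast
  have "change_of_basis S (\<lambda>i i' k. \<phi> (\<iota> (\<gamma> i i' k))) T (\<lambda>j j' l. \<phi> (\<iota> (\<delta> j j' l)))
      (\<lambda>i j. \<phi> (P i j)) (\<lambda>j i. \<phi> (Q j i))"
    using R by (intro change_of_basis_hom[OF R(1) \<phi>(1) cb]) auto
  then show "\<exists>P Q. change_of_basis S \<gamma> T \<delta> P Q" by (auto simp: \<phi>(2))
qed


section \<open>Coordinates on an algebra and on its scalar extension\<close>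

locale based_algebra = nonassoc_algebra scale mult + finite_dimensional_vector_space scale Basis
  for scale :: "'k::field \<Rightarrow> 'a::ab_group_add \<Rightarrow> 'a" and mult and Basis
begin

abbreviation coord :: "'a \<Rightarrow> 'a \<Rightarrow> 'k"
  where "coord \<equiv> representation Basis"

definition structure_const :: "'a \<Rightarrow> 'a \<Rightarrow> 'a \<Rightarrow> 'k"
  where "structure_const i j k = coord (mult i j) k"

lemma coord_add: "coord (a + b) k = coord a k + coord b k"
  by (simp add: representation_add independent_Basis span_Basis)

lemma coord_scale: "coord (scale c a) k = c * coord a k"
  by (simp add: representation_scale independent_Basis span_Basis)

lemma coord_sum: "coord (sum f I) k = (\<Sum>i\<in>I. coord (f i) k)"
  by (simp add: representation_sum independent_Basis span_Basis)

lemma coord_outside: "k \<notin> Basis \<Longrightarrow> coord a k = 0"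
  using representation_ne_zero by blast

lemma coord_basis: "b \<in> Basis \<Longrightarrow> coord b k = (if k = b then 1 else 0)"
  by (simp add: representation_basis independent_Basis)

lemma expand: "(\<Sum>b\<in>Basis. scale (coord a b) b) = a"
  by (rule sum_representation_eq) (simp_all add: independent_Basis span_Basis finite_Basis)

lemma mult_bilinear:
  "mult (a + a') b = mult a b + mult a' b" "mult (scale c a) b = scale c (mult a b)"
  "mult a (b + b') = mult a b + mult a b'" "mult a (scale c b) = scale c (mult a b)"
  using linear_mult_left linear_mult_right unfolding Vector_Spaces.linear_iff by blast+

lemma mult_sum_left: "mult (sum f I) b = (\<Sum>i\<in>I. mult (f i) b)"
  using mult_bilinear(2)[of 0 _ b]
  by (induction I rule: infinite_finite_induct) (auto simp: mult_bilinear(1))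

lemma mult_sum_right: "mult a (sum f I) = (\<Sum>i\<in>I. mult a (f i))"
  using mult_bilinear(4)[of a 0]
  by (induction I rule: infinite_finite_induct) (auto simp: mult_bilinear(3))

lemma coord_mult:
  "coord (mult a b) k = (\<Sum>i\<in>Basis. \<Sum>j\<in>Basis. coord a i * coord b j * structure_const i j k)"
proof -
  have "mult a b = mult (\<Sum>i\<in>Basis. scale (coord a i) i) (\<Sum>j\<in>Basis. scale (coord b j) j)"
    by (simp only: expand)
  also have "\<dots> = (\<Sum>i\<in>Basis. \<Sum>j\<in>Basis. scale (coord a i) (scale (coord b j) (mult i j)))"
    by (simp only: mult_sum_left) (simp add: mult_sum_right mult_bilinear scale_sum_right mult.commute)
  finally show ?thesis
    by (simp add: coord_sum coord_scale structure_const_def mult.assoc)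
qed

lemma closed_algebra_of: "closed_operations (algebra_of scale mult)"
  by (simp add: closed_operations_def algebra_of_def)

lemma algebra_of_coordinates:
  "algebra_isomorphic (algebra_of scale mult) (coord_algebra Basis structure_const)"
proof -
  have "bij_betw coord UNIV {f. \<forall>i. i \<notin> Basis \<longrightarrow> f i = 0}"
  proof (rule bij_betw_byWitness[where f' = "\<lambda>f. \<Sum>b\<in>Basis. scale (f b) b"])
    show "\<forall>f\<in>{f. \<forall>i. i \<notin> Basis \<longrightarrow> f i = 0}. coord (\<Sum>b\<in>Basis. scale (f b) b) = f"
      using finite_Basis by (auto simp: fun_eq_iff coord_sum coord_scale coord_basis
          if_distrib[of "\<lambda>x. _ * x"] cong: if_cong)
  qed (auto simp: expand coord_outside)
  then have "algebra_iso (algebra_of scale mult) (coord_algebra Basis structure_const) coord"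
    by (auto simp: algebra_iso_def algebra_of_def coord_algebra_def fun_eq_iff coord_add coord_scale
        coord_mult coord_outside simp flip: coord_mult)
  then show ?thesis by (auto simp: algebra_isomorphic_def)
qed

end


text \<open>The additive extension of \<open>h\<close> to the free abelian group, with values in a ring instead of another free
abelian group.\<close>

definition frag_eval :: "('p \<Rightarrow> 'r::ring_1) \<Rightarrow> ('p \<Rightarrow>\<^sub>0 int) \<Rightarrow> 'r"
  where "frag_eval h x = (\<Sum>p\<in>Poly_Mapping.keys x. of_int (Poly_Mapping.lookup x p) * h p)"

lemma frag_eval_simps [simp]:
  "frag_eval h 0 = 0" "frag_eval h (frag_of p) = h p"
  "frag_eval h (x - y) = frag_eval h x - frag_eval h y"
proof -
  have superset: "frag_eval h z = (\<Sum>p\<in>A. of_int (Poly_Mapping.lookup z p) * h p)"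
    if "finite A" "Poly_Mapping.keys z \<subseteq> A" for A z
    unfolding frag_eval_def
    by (rule sum.mono_neutral_left) (use that in \<open>auto simp: in_keys_iff\<close>)
  let ?A = "Poly_Mapping.keys x \<union> Poly_Mapping.keys y"
  have "Poly_Mapping.keys (x - y) \<subseteq> ?A" by (rule keys_diff)
  then show "frag_eval h (x - y) = frag_eval h x - frag_eval h y"
    by (simp add: superset[of ?A] lookup_minus left_diff_distrib flip: sum_subtractf)
qed (simp_all add: frag_eval_def)

lemma frag_eval_add [simp]: "frag_eval h (x + y) = frag_eval h x + frag_eval h y"
  using frag_eval_simps(3)[of h "x + y" y] by (simp add: algebra_simps)

lemma frag_eval_sum: "frag_eval h (sum f I) = (\<Sum>i\<in>I. frag_eval h (f i))"
  by (induction I rule: infinite_finite_induct) auto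


locale scalar_extended_algebra = based_algebra scale mult Basis + field_extension \<iota>
  for scale :: "'k::field \<Rightarrow> 'a::ab_group_add \<Rightarrow> 'a" and mult and Basis
    and \<iota> :: "'k \<Rightarrow> 'f::field"
begin

abbreviation relators where "relators \<equiv> tensor_relators \<iota> scale"

text \<open>The \<open>k\<close>-th coordinate of the class of \<open>x\<close> in \<open>A \<otimes>\<^sub>K F\<close> with respect to the basis \<open>b \<otimes> 1\<close>, where \<open>b\<close>
runs through the basis of \<open>A\<close>.\<close>

definition tcoord :: "('a \<times> 'f \<Rightarrow>\<^sub>0 int) \<Rightarrow> 'a \<Rightarrow> 'f"
  where "tcoord x k = frag_eval (\<lambda>(a, c). \<iota> (coord a k) * c) x"

lemma tcoord_simps [simp]:
  "tcoord 0 k = 0" "tcoord (frag_of (a, c)) k = \<iota> (coord a k) * c"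
  "tcoord (x - y) k = tcoord x k - tcoord y k" "tcoord (x + y) k = tcoord x k + tcoord y k"
  by (simp_all add: tcoord_def)

lemma tcoord_outside: "k \<notin> Basis \<Longrightarrow> tcoord x k = 0"
  by (induction x rule: frag_induct) (auto simp: coord_outside map_zero)

lemma tcoord_smult: "tcoord (free_smult c x) k = c * tcoord x k"
  by (induction x rule: frag_induct) (auto simp: free_smult_def frag_extend_diff right_diff_distrib)

lemma map_sum: "\<iota> (sum f I) = (\<Sum>i\<in>I. \<iota> (f i))"
  by (induction I rule: infinite_finite_induct) (auto simp: map_zero map_add)

lemma tcoord_mult:
  "tcoord (free_mult mult x y) k =
    (\<Sum>i\<in>Basis. \<Sum>j\<in>Basis. tcoord x i * tcoord y j * \<iota> (structure_const i j k))"
proof (induction x rule: frag_induct)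
  case (one p)
  obtain a c where p: "p = (a, c)" by force
  show ?case
  proof (induction y rule: frag_induct)
    case (one q)
    obtain b d where q: "q = (b, d)" by force
    show ?case
      by (simp add: p q free_mult_def coord_mult map_sum map_mult sum_distrib_right sum_distrib_left
          mult.assoc mult.left_commute mult.commute)
  qed (simp_all add: free_mult_diff_right algebra_simps sum_subtractf, simp add: free_mult_swap)
qed (simp_all add: free_mult_diff_left algebra_simps sum_subtractf, simp add: free_mult_def)

lemma tcoord_relator: "s \<in> group_closure relators \<Longrightarrow> tcoord s k = 0"
proof (induction rule: group_closure.induct)
  case (base s)
  then show ?case
    by (auto elim!: tensor_relatorsE simp: coord_add map_add coord_scale map_mult ring_distribs)
qed auto

lemma group_closure_relators_sum:
  "(\<And>i. i \<in> I \<Longrightarrow> f i \<in> group_closure relators) \<Longrightarrow> sum f I \<in> group_closure relators"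
  by (induction I rule: infinite_finite_induct) (auto intro: group_closure_add)

lemma relator: "s \<in> relators \<Longrightarrow> s \<in> group_closure relators"
  by (auto intro: group_closure.base)

lemma frag_of_zero: "frag_of (0, c) \<in> group_closure relators" "frag_of (a, 0) \<in> group_closure relators"
proof -
  have "frag_of (0 + 0, c) - frag_of (0, c) - frag_of (0, c) \<in> group_closure relators"
    "frag_of (a, 0 + 0) - frag_of (a, 0) - frag_of (a, 0) \<in> group_closure relators"
    by (intro relator tensor_relatorsI)+
  then show "frag_of (0, c) \<in> group_closure relators" "frag_of (a, 0) \<in> group_closure relators"
    using group_closure_minus_iff by (fastforce simp del: group_closure_minus_iff)+
qed

lemma frag_of_sum:
  "frag_of (sum f I, c) - (\<Sum>i\<in>I. frag_of (f i, c)) \<in> group_closure relators"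
proof (induction I rule: infinite_finite_induct)
  case (insert i I)
  have "(frag_of (f i + sum f I, c) - frag_of (f i, c) - frag_of (sum f I, c)) +
      (frag_of (sum f I, c) - (\<Sum>i\<in>I. frag_of (f i, c))) \<in> group_closure relators"
    by (intro group_closure_add insert.IH relator tensor_relatorsI)
  then show ?case using insert.hyps by (simp add: algebra_simps)
qed (simp_all add: frag_of_zero)

text \<open>The elements \<open>b \<otimes> 1\<close> span \<open>A \<otimes>\<^sub>K F\<close>: expand the left factor of \<open>a \<otimes> c\<close> in the basis of \<open>A\<close> and
move the coefficients across the tensor sign.\<close>

lemma basis_expansion:
  "x - (\<Sum>b\<in>Basis. frag_of (b, tcoord x b)) \<in> group_closure relators"
proof (induction x rule: frag_induct)
  case zero
  then show ?case
    using group_closure_relators_sum[of Basis "\<lambda>b. frag_of (b, 0)"] by (simp add: frag_of_zero)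
next
  case (one p)
  obtain a c where p: "p = (a, c)" by force
  have "frag_of (\<Sum>b\<in>Basis. scale (coord a b) b, c) - (\<Sum>b\<in>Basis. frag_of (scale (coord a b) b, c))
      \<in> group_closure relators" by (rule frag_of_sum)
  moreover have "(\<Sum>b\<in>Basis. frag_of (scale (coord a b) b, c) - frag_of (b, \<iota> (coord a b) * c))
      \<in> group_closure relators"
    by (intro group_closure_relators_sum relator tensor_relatorsI refl)
  ultimately have "(frag_of (a, c) - (\<Sum>b\<in>Basis. frag_of (scale (coord a b) b, c))) +
      (\<Sum>b\<in>Basis. frag_of (scale (coord a b) b, c) - frag_of (b, \<iota> (coord a b) * c))
      \<in> group_closure relators"
    unfolding expand by (rule group_closure_add)
  then show ?case by (simp add: p sum_subtractf)
next
  case (diff x y)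
  have "(\<Sum>b\<in>Basis. frag_of (b, (tcoord x b - tcoord y b) + tcoord y b) -
      frag_of (b, tcoord x b - tcoord y b) - frag_of (b, tcoord y b)) \<in> group_closure relators"
    by (intro group_closure_relators_sum relator tensor_relatorsI)
  from group_closure_add[OF group_closure.diff[OF diff] this]
  show ?case by (simp add: sum_subtractf sum.distrib algebra_simps)
qed

text \<open>Coordinates are well defined on classes because they vanish on the relators, and they determine a class
by the basis expansion.\<close>

lemma tensor_rel_iff: "(x, y) \<in> tensor_rel \<iota> scale \<longleftrightarrow> (\<forall>k. tcoord x k = tcoord y k)"
proof
  assume "(x, y) \<in> tensor_rel \<iota> scale"
  then show "\<forall>k. tcoord x k = tcoord y k"
    using tcoord_relator[of "x - y"] by (simp add: tensor_rel_def)
next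
  assume eq: "\<forall>k. tcoord x k = tcoord y k"
  have "(x - (\<Sum>b\<in>Basis. frag_of (b, tcoord x b))) - (y - (\<Sum>b\<in>Basis. frag_of (b, tcoord y b)))
      \<in> group_closure relators"
    by (intro group_closure.diff basis_expansion)
  then show "(x, y) \<in> tensor_rel \<iota> scale" using eq by (simp add: tensor_rel_def)
qed

abbreviation tensor_class :: "('a \<times> 'f \<Rightarrow>\<^sub>0 int) \<Rightarrow> ('a \<times> 'f \<Rightarrow>\<^sub>0 int) set"
  where "tensor_class x \<equiv> tensor_rel \<iota> scale `` {x}"

lemma scalar_extension_operations:
  "alg_carrier (scalar_extension \<iota> scale mult) = range tensor_class"
  "alg_add (scalar_extension \<iota> scale mult) (tensor_class x) (tensor_class y) = tensor_class (x + y)"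
  "alg_smult (scalar_extension \<iota> scale mult) c (tensor_class x) = tensor_class (free_smult c x)"
  "alg_mult (scalar_extension \<iota> scale mult) (tensor_class x) (tensor_class y) =
    tensor_class (free_mult mult x y)"
proof -
  have alg: "nonassoc_algebra scale mult" ..
  note eqv = equiv_tensor_rel[of \<iota> scale]
  show "alg_carrier (scalar_extension \<iota> scale mult) = range tensor_class"
    by (auto simp: scalar_extension_def Let_def quotient_def)
  show "alg_add (scalar_extension \<iota> scale mult) (tensor_class x) (tensor_class y) = tensor_class (x + y)"
    using UN_equiv_class2[OF eqv eqv congruent_add UNIV_I UNIV_I]
    by (simp only: scalar_extension_def Let_def algebra_data.simps)
  show "alg_smult (scalar_extension \<iota> scale mult) c (tensor_class x) = tensor_class (free_smult c x)"
    using UN_equiv_class[OF eqv congruent_smult UNIV_I]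
    by (simp only: scalar_extension_def Let_def algebra_data.simps)
  show "alg_mult (scalar_extension \<iota> scale mult) (tensor_class x) (tensor_class y) =
    tensor_class (free_mult mult x y)"
    using UN_equiv_class2[OF eqv eqv congruent_mult[OF alg] UNIV_I UNIV_I]
    by (simp only: scalar_extension_def Let_def algebra_data.simps)
qed

lemma closed_scalar_extension: "closed_operations (scalar_extension \<iota> scale mult)"
  by (auto simp: closed_operations_def scalar_extension_operations)

lemma scalar_extension_coordinates:
  "algebra_isomorphic (scalar_extension \<iota> scale mult)
    (coord_algebra Basis (\<lambda>i j k. \<iota> (structure_const i j k)))"
proof -
  \<comment> \<open>The choice of a representative does not matter, by \<open>tensor_rel_iff\<close>.\<close>
  define \<kappa> where "\<kappa> X = tcoord (SOME x. x \<in> X)" for X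
  have \<kappa>: "\<kappa> (tensor_class x) = tcoord x" for x
  proof -
    define z where "z = (SOME y. y \<in> tensor_class x)"
    have "z \<in> tensor_class x"
      unfolding z_def by (rule someI[of _ x]) (simp add: tensor_rel_iff)
    then have "tcoord x k = tcoord z k" for k by (simp add: tensor_rel_iff)
    then show ?thesis unfolding \<kappa>_def z_def[symmetric] by (simp add: fun_eq_iff)
  qed
  have "inj_on \<kappa> (range tensor_class)"
    by (auto simp: inj_on_def \<kappa> tensor_rel_iff)
  moreover have "\<exists>x. tcoord x = f" if "\<forall>i. i \<notin> Basis \<longrightarrow> f i = 0" for f
  proof
    show "tcoord (\<Sum>b\<in>Basis. frag_of (b, f b)) = f"
    proof
      fix k
      have "tcoord (\<Sum>b\<in>Basis. frag_of (b, f b)) k = (\<Sum>b\<in>Basis. \<iota> (coord b k) * f b)"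
        by (simp add: tcoord_def frag_eval_sum)
      also have "\<dots> = (\<Sum>b\<in>Basis. if k = b then f b else 0)"
        by (intro sum.cong) (auto simp: coord_basis map_one map_zero)
      also have "\<dots> = f k" using that finite_Basis by simp
      finally show "tcoord (\<Sum>b\<in>Basis. frag_of (b, f b)) k = f k" .
    qed
  qed
  then have "\<kappa> ` range tensor_class = {f. \<forall>i. i \<notin> Basis \<longrightarrow> f i = 0}"
    by (auto simp: \<kappa> tcoord_outside image_image) (metis rangeI)
  ultimately have "bij_betw \<kappa> (range tensor_class) {f. \<forall>i. i \<notin> Basis \<longrightarrow> f i = 0}"
    by (simp add: bij_betw_def)
  then have "algebra_iso (scalar_extension \<iota> scale mult)
      (coord_algebra Basis (\<lambda>i j k. \<iota> (structure_const i j k))) \<kappa>"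
    unfolding algebra_iso_def scalar_extension_operations(1)
    by (auto simp: scalar_extension_operations(2-4) \<kappa> coord_algebra_def fun_eq_iff tcoord_smult
        tcoord_outside simp flip: tcoord_mult)
  then show ?thesis by (auto simp: algebra_isomorphic_def)
qed

end


section \<open>Isomorphism before and after scalar extension\<close>

theorem theorem4p3:
  fixes \<iota> :: "'k::alg_closed_field \<Rightarrow> 'f::field"
    and scaleA :: "'k \<Rightarrow> 'a::ab_group_add \<Rightarrow> 'a" and multA :: "'a \<Rightarrow> 'a \<Rightarrow> 'a"
    and scaleB :: "'k \<Rightarrow> 'b::ab_group_add \<Rightarrow> 'b" and multB :: "'b \<Rightarrow> 'b \<Rightarrow> 'b"
  assumes "field_extension \<iota>"
    and "nonassoc_algebra scaleA multA"
    and "\<exists>S. finite_dimensional_vector_space scaleA S"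
    and "nonassoc_algebra scaleB multB"
    and "\<exists>S. finite_dimensional_vector_space scaleB S"
  shows "algebra_isomorphic (scalar_extension \<iota> scaleA multA) (scalar_extension \<iota> scaleB multB)
    \<longleftrightarrow> algebra_isomorphic (algebra_of scaleA multA) (algebra_of scaleB multB)"
proof -
  obtain S T where S: "finite_dimensional_vector_space scaleA S"
    and T: "finite_dimensional_vector_space scaleB T"
    using assms(3,5) by blast
  interpret A: scalar_extended_algebra scaleA multA S \<iota>
    using assms(1,2) S by (simp add: scalar_extended_algebra_def based_algebra_def)
  interpret B: scalar_extended_algebra scaleB multB T \<iota>
    using assms(1,4) T by (simp add: scalar_extended_algebra_def based_algebra_def)
  have "algebra_isomorphic (scalar_extension \<iota> scaleA multA) (scalar_extension \<iota> scaleB multB) \<longleftrightarrow>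
      algebra_isomorphic (coord_algebra S (\<lambda>i j k. \<iota> (A.structure_const i j k)))
        (coord_algebra T (\<lambda>i j k. \<iota> (B.structure_const i j k)))"
    by (intro algebra_isomorphic_cong A.closed_scalar_extension B.closed_scalar_extension
        A.scalar_extension_coordinates B.scalar_extension_coordinates)
  also have "\<dots> \<longleftrightarrow> algebra_isomorphic (coord_algebra S A.structure_const)
      (coord_algebra T B.structure_const)"
    using change_of_basis_descends[OF assms(1) A.finite_Basis B.finite_Basis]
    by (simp only: isomorphic_iff_change_of_basis[OF A.finite_Basis B.finite_Basis])
  also have "\<dots> \<longleftrightarrow> algebra_isomorphic (algebra_of scaleA multA) (algebra_of scaleB multB)"
    by (intro algebra_isomorphic_cong[symmetric] A.closed_algebra_of B.closed_algebra_of
        A.algebra_of_coordinates B.algebra_of_coordinates)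
  finally show ?thesis .
qed

end
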